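(* Assume CH. If $\mathcal{X}=\{X_\xi:\xi<\kappa\}$ is a safe collection of relevant spaces, then $P(\mathcal{X})$ is totally proper.
   Context: A free sequence in $X$ is $\langle x_\alpha:\alpha<\lambda\rangle$ with $\mathrm{cl}\{x_\alpha:\alpha<\beta\}\cap\mathrm{cl}\{x_\alpha:\alpha\ge\beta\}=\emptyset$ for all $\beta<\lambda$. A space $X$ is relevant if it is first countable, countably compact, non--compact, regular, $|X|=\aleph_1$, and has no uncountable free sequence. For each relevant $X$ one fixes a maximal filter $\mathcal{U}_X$ of closed subsets of $X$ with empty intersection, and a set $Y_X\subseteq X$ diagonalizing $\mathcal{U}_X$ ($Y_X$ meets every member of $\mathcal{U}_X$, and $Y_X\setminus A$ is countable for each $A\in\mathcal{U}_X$) that is right--separated in type $\omega_1$; $Y_X$ is identified with $\omega_1$ so that initial segments are open in $Y_X$, so each $\alpha<\omega_1$ is a point of every relevant space. One also fixes $\mathcal{B}$ such that for each relevant $X$ and $\alpha<\omega_1$, $\langle\mathcal{B}(X,\alpha,n):n\in\omega\rangle$ is a decreasing neighborhood base at $\alpha$ in $X$. A promise is a function with uncountable domain $\subseteq\omega_1$ and values in $\omega$. Write $\mathcal{U}_\xi=\mathcal{U}_{X_\xi}$. $P(\mathcal{X})$: conditions are $p=(a_p,\Phi_p)$ where $a_p$ is a $\{0,1\}$-valued function with countable domain $\subseteq\{(\xi,x):\xi<\kappa,x\in X_\xi\}$ such that for every $\xi$, $[p]_\xi=\{x\in X_\xi:a_p(\xi,x)=1\}$ satisfies $\mathrm{cl}_{X_\xi}[p]_\xi\notin\mathcal{U}_\xi$,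 and $\Phi_p$ is a countable set of pairs $(v,f)$ with $v\subseteq\kappa$ finite and $f$ a promise. $q\le p$ iff $a_q\supseteq a_p$, $\Phi_q\supseteq\Phi_p$, and for each $(v,f)\in\Phi_p$ the set $Y(v,f,q,p)=\{\alpha\in\mathrm{dom} f:(\forall\xi\in v)\,[q]_\xi\setminus[p]_\xi\subseteq\mathcal{B}(X_\xi,\alpha,f(\alpha))\}$ is uncountable and $(v,f\restriction Y(v,f,q,p))\in\Phi_q$. For finite $v\subseteq\kappa$, $X_v=\prod_{\xi\in v}X_\xi$ and $\mathcal{U}_v$ is the filter of closed subsets of $X_v$ generated by the sets $\prod_{\xi\in v}A_\xi$ with $A_\xi\in\mathcal{U}_\xi$; a set is $\mathcal{U}_v$--large if it meets every member of $\mathcal{U}_v$. A point $(x_\xi:\xi\in v)\in X_v$ is banned by $(v,f)$ if $\{\alpha\in\mathrm{dom} f:(\forall\xi\in v)\,x_\xi\in\mathcal{B}(X_\xi,\alpha,f(\alpha))\}$ is countable; $\mathrm{ban}(v,f)$ is the set of such points. $v$ is dangerous if there is a promise $f$ with $\mathrm{ban}(v,f)$ $\mathcal{U}_v$--large; $\mathcal{X}$ is safe if no finite $v\subseteq\kappa$ is dangerous. A notion of forcing $P$ is totally proper if for every countable $N\prec H(\lambda)$ ($\lambda$ large regular) with $P\in N$ and every $p\in N\cap P$ there is a decreasing sequence $\langle p_n\rangle\subseteq N\cap P$ with $p_0=p$, meeting every dense open subset of $P$ in $N$, and having a lower bound. *)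

theory Defs
  imports "HOL-Analysis.Analysis" "HOL-Library.Countable_Set_Type"
begin

unbundle cardinal_syntax

section \<open>The ordinal \<open>\<omega>\<^sub>1\<close> and CH\<close>

text \<open>The relation \<^term>\<open>cardSuc natLeq\<close> is an initial well-order of cardinality \<open>\<aleph>\<^sub>1\<close>;
  its field, with this order, serves as \<open>\<omega>\<^sub>1\<close>.\<close>

typedef omega1 = "Field (cardSuc natLeq)"
proof -
  have "Field (cardSuc natLeq) \<noteq> {}"
    using cardSuc_finite[OF natLeq_Card_order] Field_natLeq by auto
  then show ?thesis by blast
qed

lemma Well_order_cardSuc_natLeq: "Well_order (cardSuc natLeq)"
  using cardSuc_Card_order[OF natLeq_Card_order] card_order_on_def by blast

instantiation omega1 :: wellorder
begin

definition less_eq_omega1 :: "omega1 \<Rightarrow> omega1 \<Rightarrow> bool" where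
  "a \<le> b \<longleftrightarrow> (Rep_omega1 a, Rep_omega1 b) \<in> cardSuc natLeq"

definition less_omega1 :: "omega1 \<Rightarrow> omega1 \<Rightarrow> bool" where
  "a < b \<longleftrightarrow> a \<le> b \<and> \<not> b \<le> a" for a b :: omega1

instance
proof
  note wo = Well_order_cardSuc_natLeq
  let ?r = "cardSuc natLeq"
  have refl: "\<And>x. x \<in> Field ?r \<Longrightarrow> (x, x) \<in> ?r"
    and trans: "trans ?r" and antisym: "antisym ?r"
    and tot: "\<And>x y. x \<in> Field ?r \<Longrightarrow> y \<in> Field ?r \<Longrightarrow> x \<noteq> y \<Longrightarrow> (x, y) \<in> ?r \<or> (y, x) \<in> ?r"
    and wf: "wf (?r - Id)"
    using wo unfolding well_order_on_def linear_order_on_def partial_order_on_def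
      preorder_on_def refl_on_def total_on_def by blast+
  fix a b c :: omega1
  show "(a < b) = (a \<le> b \<and> \<not> b \<le> a)" by (rule less_omega1_def)
  show "a \<le> a" by (simp add: less_eq_omega1_def refl Rep_omega1)
  show "a \<le> b \<Longrightarrow> b \<le> c \<Longrightarrow> a \<le> c"
    using trans unfolding less_eq_omega1_def trans_def by blast
  show anti: "a \<le> b \<Longrightarrow> b \<le> a \<Longrightarrow> a = b" for a b :: omega1
    using antisym unfolding less_eq_omega1_def antisym_def by (metis Rep_omega1_inject)
  show "a \<le> b \<or> b \<le> a"
    using tot[OF Rep_omega1 Rep_omega1] refl[OF Rep_omega1]
    unfolding less_eq_omega1_def by metis
  fix P :: "omega1 \<Rightarrow> bool"
  assume step: "\<And>x. (\<And>y. y < x \<Longrightarrow> P y) \<Longrightarrow> P x"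
  have "wf {(x, y). (Rep_omega1 x, Rep_omega1 y) \<in> ?r - Id}"
    using wf_inv_image[OF wf, of Rep_omega1] by (simp add: inv_image_def)
  then show "P a"
  proof (induction a rule: wf_induct_rule)
    case (less x)
    show ?case
    proof (rule step)
      fix y assume "y < x"
      then have "y \<le> x" "y \<noteq> x" by (auto simp: less_omega1_def)
      then show "P y"
        using less by (auto simp: less_eq_omega1_def Rep_omega1_inject)
    qed
  qed
qed

end

lemma uncountable_omega1: "uncountable (UNIV :: omega1 set)"
proof
  assume "countable (UNIV :: omega1 set)"
  then have "countable (Field (cardSuc natLeq))"
    by (metis countable_image type_definition.Rep_range type_definition_omega1)
  then have "|Field (cardSuc natLeq)| \<le>o natLeq"
    by (simp add: countable_card_le_natLeq)
  moreover have "cardSuc natLeq =o |Field (cardSuc natLeq)|"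
    by (simp add: card_of_Field_ordIso cardSuc_Card_order natLeq_Card_order ordIso_symmetric)
  ultimately have "cardSuc natLeq \<le>o natLeq"
    using ordIso_ordLeq_trans by blast
  then show False
    using cardSuc_greater[OF natLeq_Card_order] not_ordLess_ordLeq by blast
qed

lemma countable_lessThan_omega1: "countable {..<a}" for a :: omega1
proof -
  let ?r = "cardSuc natLeq"
  have "|underS ?r (Rep_omega1 a)| <o ?r"
    by (rule card_of_underS[OF cardSuc_Card_order[OF natLeq_Card_order] Rep_omega1])
  then have "|underS ?r (Rep_omega1 a)| \<le>o natLeq"
    using cardSuc_ordLeq_ordLess[OF natLeq_Card_order card_of_Card_order] by blast
  then have "countable (underS ?r (Rep_omega1 a))"
    by (simp add: countable_card_le_natLeq)
  moreover have "Rep_omega1 ` {..<a} \<subseteq> underS ?r (Rep_omega1 a)"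
    by (auto simp: underS_def less_omega1_def less_eq_omega1_def Rep_omega1_inject)
  ultimately have "countable (Rep_omega1 ` {..<a})"
    using countable_subset by blast
  then show ?thesis
    by (metis Rep_omega1_inject countable_image_inj_on inj_onI)
qed

definition CH :: bool where
  "CH \<longleftrightarrow> |UNIV :: real set| =o cardSuc natLeq"

section \<open>Relevant spaces\<close>

definition countably_compact_space :: "'a topology \<Rightarrow> bool" where
  "countably_compact_space Z \<longleftrightarrow>
    (\<forall>\<C>. countable \<C> \<and> (\<forall>C\<in>\<C>. openin Z C) \<and> topspace Z \<subseteq> \<Union>\<C> \<longrightarrow>
       (\<exists>\<F>. finite \<F> \<and> \<F> \<subseteq> \<C> \<and> topspace Z \<subseteq> \<Union>\<F>))"

text \<open>A sequence indexed by an ordinal is indexed here by the field of a well-order \<open>r\<close>.\<close>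

definition free_sequence :: "'a topology \<Rightarrow> 'i rel \<Rightarrow> ('i \<Rightarrow> 'a) \<Rightarrow> bool" where
  "free_sequence Z r x \<longleftrightarrow> Well_order r \<and> x ` Field r \<subseteq> topspace Z \<and>
    (\<forall>\<beta>\<in>Field r. Z closure_of (x ` underS r \<beta>) \<inter> Z closure_of (x ` above r \<beta>) = {})"

text \<open>The terms of a free sequence are pairwise distinct, so its length is always the order type
  of some well-order on a set of points; hence \<open>'a rel\<close> suffices for the index orders.
  Regularity includes \<open>T\<^sub>1\<close>, which \<^const>\<open>regular_space\<close> does not.\<close>

definition relevant :: "'a topology \<Rightarrow> bool" where
  "relevant Z \<longleftrightarrow>
    first_countable Z \<and> countably_compact_space Z \<and> \<not> compact_space Z \<and>
    regular_space Z \<and> t1_space Z \<and> |topspace Z| =o cardSuc natLeq \<and>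
    \<not> (\<exists>(r :: 'a rel) x. free_sequence Z r x \<and> uncountable (Field r))"

section \<open>Filters of closed sets and the fixed data\<close>

definition closed_filter :: "'a topology \<Rightarrow> 'a set set \<Rightarrow> bool" where
  "closed_filter Z F \<longleftrightarrow>
    F \<subseteq> {C. closedin Z C} \<and> topspace Z \<in> F \<and> {} \<notin> F \<and>
    (\<forall>A\<in>F. \<forall>B\<in>F. A \<inter> B \<in> F) \<and> (\<forall>A\<in>F. \<forall>C. closedin Z C \<and> A \<subseteq> C \<longrightarrow> C \<in> F)"

definition maximal_closed_filter :: "'a topology \<Rightarrow> 'a set set \<Rightarrow> bool" where
  "maximal_closed_filter Z F \<longleftrightarrow>
    closed_filter Z F \<and> (\<forall>G. closed_filter Z G \<and> F \<subseteq> G \<longrightarrow> G = F)"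

definition generated_closed_filter :: "'a topology \<Rightarrow> 'a set set \<Rightarrow> 'a set set" where
  "generated_closed_filter Z S = \<Inter>{F. closed_filter Z F \<and> S \<subseteq> F}"

definition large :: "'a set set \<Rightarrow> 'a set \<Rightarrow> bool" where
  "large F S \<longleftrightarrow> (\<forall>A\<in>F. S \<inter> A \<noteq> {})"

definition diagonalizes :: "'a set \<Rightarrow> 'a set set \<Rightarrow> bool" where
  "diagonalizes Y F \<longleftrightarrow> (\<forall>A\<in>F. Y \<inter> A \<noteq> {}) \<and> (\<forall>A\<in>F. countable (Y - A))"

text \<open>The identification of a set \<open>Y\<close> of points, right-separated in type \<open>\<omega>\<^sub>1\<close>, with \<open>\<omega>\<^sub>1\<close> is kept
  as an explicit enumeration \<open>e\<close>; the countable ordinal \<open>\<alpha>\<close> is the point \<open>e \<alpha>\<close>.\<close>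

definition right_separated_by :: "'a topology \<Rightarrow> 'a set \<Rightarrow> (omega1 \<Rightarrow> 'a) \<Rightarrow> bool" where
  "right_separated_by Z Y e \<longleftrightarrow>
    Y \<subseteq> topspace Z \<and> bij_betw e UNIV Y \<and>
    (\<forall>\<beta>. openin (subtopology Z Y) (e ` {..<\<beta>}))"

text \<open>Neighborhoods are taken to be open, as in Engelking.\<close>

definition decreasing_nbhd_base :: "'a topology \<Rightarrow> 'a \<Rightarrow> (nat \<Rightarrow> 'a set) \<Rightarrow> bool" where
  "decreasing_nbhd_base Z x b \<longleftrightarrow>
    (\<forall>n. openin Z (b n) \<and> x \<in> b n) \<and> (\<forall>n. b (Suc n) \<subseteq> b n) \<and>
    (\<forall>W. openin Z W \<and> x \<in> W \<longrightarrow> (\<exists>n. b n \<subseteq> W))"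

definition fixed_data ::
  "('a topology \<Rightarrow> 'a set set) \<Rightarrow> ('a topology \<Rightarrow> 'a set) \<Rightarrow> ('a topology \<Rightarrow> omega1 \<Rightarrow> 'a) \<Rightarrow>
   ('a topology \<Rightarrow> omega1 \<Rightarrow> nat \<Rightarrow> 'a set) \<Rightarrow> bool" where
  "fixed_data \<U> Y e \<B> \<longleftrightarrow> (\<forall>Z. relevant Z \<longrightarrow>
    maximal_closed_filter Z (\<U> Z) \<and> \<Inter>(\<U> Z) = {} \<and>
    diagonalizes (Y Z) (\<U> Z) \<and> right_separated_by Z (Y Z) (e Z) \<and>
    (\<forall>\<alpha>. decreasing_nbhd_base Z (e Z \<alpha>) (\<B> Z \<alpha>)))"

section \<open>The forcing\<close>

type_synonym promise = "omega1 \<rightharpoonup> nat"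

text \<open>A condition is a pair \<open>(a, \<Phi>)\<close>; \<^const>\<open>True\<close> and \<^const>\<open>False\<close> stand for the values 1 and 0
  of \<open>a\<close>.\<close>

type_synonym ('k, 'a) cond = "('k \<times> 'a \<rightharpoonup> bool) \<times> ('k set \<times> promise) set"

definition is_promise :: "promise \<Rightarrow> bool" where
  "is_promise f \<longleftrightarrow> uncountable (dom f)"

definition cond_section :: "('k, 'a) cond \<Rightarrow> 'k \<Rightarrow> 'a set" where
  "cond_section p \<xi> = {x. fst p (\<xi>, x) = Some True}"

definition conds ::
  "('a topology \<Rightarrow> 'a set set) \<Rightarrow> 'k set \<Rightarrow> ('k \<Rightarrow> 'a topology) \<Rightarrow> ('k, 'a) cond set" where
  "conds \<U> K X = {(a, \<Phi>).
    countable (dom a) \<and> dom a \<subseteq> Sigma K (\<lambda>\<xi>. topspace (X \<xi>)) \<and>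
    (\<forall>\<xi>\<in>K. X \<xi> closure_of cond_section (a, \<Phi>) \<xi> \<notin> \<U> (X \<xi>)) \<and>
    countable \<Phi> \<and> (\<forall>(v, f)\<in>\<Phi>. finite v \<and> v \<subseteq> K \<and> is_promise f)}"

definition kept_set ::
  "('a topology \<Rightarrow> omega1 \<Rightarrow> nat \<Rightarrow> 'a set) \<Rightarrow> ('k \<Rightarrow> 'a topology) \<Rightarrow>
   'k set \<Rightarrow> promise \<Rightarrow> ('k, 'a) cond \<Rightarrow> ('k, 'a) cond \<Rightarrow> omega1 set" where
  "kept_set \<B> X v f q p = {\<alpha> \<in> dom f.
    \<forall>\<xi>\<in>v. cond_section q \<xi> - cond_section p \<xi> \<subseteq> \<B> (X \<xi>) \<alpha> (the (f \<alpha>))}"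

definition cond_le ::
  "('a topology \<Rightarrow> omega1 \<Rightarrow> nat \<Rightarrow> 'a set) \<Rightarrow> ('k \<Rightarrow> 'a topology) \<Rightarrow>
   ('k, 'a) cond \<Rightarrow> ('k, 'a) cond \<Rightarrow> bool" where
  "cond_le \<B> X q p \<longleftrightarrow> fst p \<subseteq>\<^sub>m fst q \<and> snd p \<subseteq> snd q \<and>
    (\<forall>(v, f)\<in>snd p. uncountable (kept_set \<B> X v f q p) \<and>
       (v, f |` kept_set \<B> X v f q p) \<in> snd q)"

section \<open>Safe collections\<close>

definition product_filter ::
  "('a topology \<Rightarrow> 'a set set) \<Rightarrow> ('k \<Rightarrow> 'a topology) \<Rightarrow> 'k set \<Rightarrow> ('k \<Rightarrow> 'a) set set" where
  "product_filter \<U> X v = generated_closed_filter (product_topology X v)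
    {Pi\<^sub>E v A |A. \<forall>\<xi>\<in>v. A \<xi> \<in> \<U> (X \<xi>)}"

definition ban ::
  "('a topology \<Rightarrow> omega1 \<Rightarrow> nat \<Rightarrow> 'a set) \<Rightarrow> ('k \<Rightarrow> 'a topology) \<Rightarrow>
   'k set \<Rightarrow> promise \<Rightarrow> ('k \<Rightarrow> 'a) set" where
  "ban \<B> X v f = {x \<in> topspace (product_topology X v).
    countable {\<alpha> \<in> dom f. \<forall>\<xi>\<in>v. x \<xi> \<in> \<B> (X \<xi>) \<alpha> (the (f \<alpha>))}}"

definition dangerous ::
  "('a topology \<Rightarrow> 'a set set) \<Rightarrow> ('a topology \<Rightarrow> omega1 \<Rightarrow> nat \<Rightarrow> 'a set) \<Rightarrow>
   ('k \<Rightarrow> 'a topology) \<Rightarrow> 'k set \<Rightarrow> bool" where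
  "dangerous \<U> \<B> X v \<longleftrightarrow>
    (\<exists>f. is_promise f \<and> large (product_filter \<U> X v) (ban \<B> X v f))"

definition safe ::
  "('a topology \<Rightarrow> 'a set set) \<Rightarrow> ('a topology \<Rightarrow> omega1 \<Rightarrow> nat \<Rightarrow> 'a set) \<Rightarrow>
   'k set \<Rightarrow> ('k \<Rightarrow> 'a topology) \<Rightarrow> bool" where
  "safe \<U> \<B> K X \<longleftrightarrow> (\<forall>v. finite v \<and> v \<subseteq> K \<longrightarrow> \<not> dangerous \<U> \<B> X v)"

section \<open>The structure \<open>H(\<lambda>)\<close> and elementary submodels\<close>

definition mems :: "'m set \<Rightarrow> ('m \<Rightarrow> 'm \<Rightarrow> bool) \<Rightarrow> 'm \<Rightarrow> 'm set" where
  "mems M E m = {x \<in> M. E x m}"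

definition mem_rel :: "'m set \<Rightarrow> ('m \<Rightarrow> 'm \<Rightarrow> bool) \<Rightarrow> 'm rel" where
  "mem_rel M E = {(x, y). x \<in> M \<and> y \<in> M \<and> E x y}"

text \<open>HOL has no universe of sets, so \<open>(H(\<lambda>), \<in>)\<close> is described up to isomorphism: \<open>(M, E)\<close> is
  well-founded and extensional, and a subset \<open>S\<close> of \<open>M\<close> is (the extension of) an element of \<open>M\<close> iff
  its transitive closure, computed in \<open>M\<close>, has fewer than \<open>\<lambda>\<close> elements. Its Mostowski collapse is
  exactly the set of all sets whose transitive closure has fewer than \<open>\<lambda>\<close> elements.\<close>

definition H_structure :: "'l rel \<Rightarrow> 'm set \<Rightarrow> ('m \<Rightarrow> 'm \<Rightarrow> bool) \<Rightarrow> bool" where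
  "H_structure lam M E \<longleftrightarrow>
    wf (mem_rel M E) \<and> inj_on (mems M E) M \<and>
    (\<forall>S\<subseteq>M. (\<exists>m\<in>M. mems M E m = S) \<longleftrightarrow> |((mem_rel M E)\<^sup>*)\<inverse> `` S| <o lam)"

text \<open>First-order formulas of the language of set theory; variables are natural numbers.\<close>

datatype set_fm =
    FMem nat nat
  | FEq nat nat
  | FNeg set_fm
  | FConj set_fm set_fm
  | FEx nat set_fm

primrec sat :: "'m set \<Rightarrow> ('m \<Rightarrow> 'm \<Rightarrow> bool) \<Rightarrow> (nat \<Rightarrow> 'm) \<Rightarrow> set_fm \<Rightarrow> bool" where
  "sat M E s (FMem i j) \<longleftrightarrow> E (s i) (s j)"
| "sat M E s (FEq i j) \<longleftrightarrow> s i = s j"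
| "sat M E s (FNeg \<phi>) \<longleftrightarrow> \<not> sat M E s \<phi>"
| "sat M E s (FConj \<phi> \<psi>) \<longleftrightarrow> sat M E s \<phi> \<and> sat M E s \<psi>"
| "sat M E s (FEx i \<phi>) \<longleftrightarrow> (\<exists>a\<in>M. sat M E (s(i := a)) \<phi>)"

definition elementary_submodel :: "'m set \<Rightarrow> 'm set \<Rightarrow> ('m \<Rightarrow> 'm \<Rightarrow> bool) \<Rightarrow> bool" where
  "elementary_submodel N M E \<longleftrightarrow> N \<noteq> {} \<and> N \<subseteq> M \<and>
    (\<forall>\<phi> s. range s \<subseteq> N \<longrightarrow> (sat N E s \<phi> \<longleftrightarrow> sat M E s \<phi>))"

text \<open>\<open>z\<close> is the Kuratowski pair \<open>{{x}, {x, y}}\<close>.\<close>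

definition is_pair :: "'m set \<Rightarrow> ('m \<Rightarrow> 'm \<Rightarrow> bool) \<Rightarrow> 'm \<Rightarrow> 'm \<Rightarrow> 'm \<Rightarrow> bool" where
  "is_pair M E z x y \<longleftrightarrow>
    (\<exists>u\<in>M. \<exists>w\<in>M. mems M E u = {x} \<and> mems M E w = {x, y} \<and> mems M E z = {u, w})"

text \<open>When the conditions \<open>p \<in> P\<close> are represented by the sets \<open>c p\<close>, the element \<open>m\<close> is the
  ordered pair consisting of the set of conditions and the (graph of the) order.\<close>

definition codes_forcing ::
  "'m set \<Rightarrow> ('m \<Rightarrow> 'm \<Rightarrow> bool) \<Rightarrow> ('p \<Rightarrow> 'm) \<Rightarrow> 'p set \<Rightarrow> ('p \<Rightarrow> 'p \<Rightarrow> bool) \<Rightarrow> 'm \<Rightarrow> bool" where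
  "codes_forcing M E c P le m \<longleftrightarrow>
    (\<exists>mP\<in>M. \<exists>mL\<in>M. is_pair M E m mP mL \<and> mems M E mP = c ` P \<and>
      mems M E mL = {z \<in> M. \<exists>p\<in>P. \<exists>q\<in>P. le p q \<and> is_pair M E z (c p) (c q)})"

section \<open>Total properness\<close>

definition dense_open :: "'p set \<Rightarrow> ('p \<Rightarrow> 'p \<Rightarrow> bool) \<Rightarrow> 'p set \<Rightarrow> bool" where
  "dense_open P le D \<longleftrightarrow> D \<subseteq> P \<and> (\<forall>p\<in>P. \<exists>q\<in>D. le q p) \<and> (\<forall>p\<in>D. \<forall>q\<in>P. le q p \<longrightarrow> q \<in> D)"

text \<open>``\<open>\<lambda>\<close> large regular'' means that \<open>\<lambda>\<close> is an uncountable regular cardinal with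
  \<open>2\<^bsup>|P|\<^esup> < \<lambda>\<close>, as usual for proper forcing. All representations \<open>c\<close> of the
  conditions by elements of \<open>H(\<lambda>)\<close> are considered. The type \<open>'m\<close> bounds the size of the
  structures \<open>H(\<lambda>)\<close>; a theorem in which it is a type variable covers all regular \<open>\<lambda>\<close>.
  Since \<open>\<lambda> \<subseteq> H(\<lambda>)\<close>, every \<open>\<lambda>\<close> that matters is represented by a relation on \<open>'m\<close>.\<close>

definition totally_proper :: "'m itself \<Rightarrow> 'p set \<Rightarrow> ('p \<Rightarrow> 'p \<Rightarrow> bool) \<Rightarrow> bool" where
  "totally_proper _ P le \<longleftrightarrow>
    (\<forall>(lam :: 'm rel) M E (c :: 'p \<Rightarrow> 'm) N m.
      Card_order lam \<and> regularCard lam \<and> natLeq <o lam \<and> |Pow P| <o lam \<and>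
      H_structure lam M E \<and> inj_on c P \<and> codes_forcing M E c P le m \<and>
      countable N \<and> elementary_submodel N M E \<and> m \<in> N \<longrightarrow>
      (\<forall>p\<in>P. c p \<in> N \<longrightarrow>
        (\<exists>s. s 0 = p \<and>
          (\<forall>n. s n \<in> P \<and> c (s n) \<in> N \<and> le (s (Suc n)) (s n)) \<and>
          (\<forall>D. dense_open P le D \<and> (\<exists>d\<in>N. mems M E d = c ` D) \<longrightarrow> (\<exists>n. s n \<in> D)) \<and>
          (\<exists>q\<in>P. \<forall>n. le q (s n)))))"

end

theory Submission
  imports Defs
begin

text \<open>A point \<open>\<alpha>\<close> of the diagonal is close to a condition \<open>p\<close> if every dense set contains extensions of
  \<open>p\<close> that add only points near \<open>\<alpha>\<close> in a given finite set \<open>v\<close> of coordinates. By CH the extensions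
  have only \<open>\<aleph>\<^sub>1\<close> traces on \<open>v\<close>, and the promise mechanism shows that for all but countably many
  \<open>\<alpha>\<close> a trace listed before \<open>\<alpha>\<close> can be found. So for \<open>\<delta> = N \<inter> \<omega>\<^sub>1\<close> the extensions can be taken
  in \<open>N\<close>. Safety says that for every promise \<open>(v, f)\<close> in \<open>N\<close> the point \<open>\<delta>\<close> lies in uncountably many of
  the prescribed neighborhoods, hence uncountably many of them contain the same basic neighborhood
  of \<open>\<delta>\<close>; a generic sequence whose later stages stay in this neighborhood keeps the promise at
  its limit, and it also has small closures since \<open>\<U>\<close> does not converge to \<open>\<delta>\<close>.

  The model \<open>N\<close> only contains the poset, not the spaces. So one first finds in \<open>H(\<lambda>)\<close> a function
  \<open>F\<close> such that every countable set closed under \<open>F\<close> admits generic chains with a lower bound. This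
  property of \<open>F\<close> is first-order over \<open>H(\<lambda>)\<close>, so such an \<open>F\<close> exists in \<open>N\<close>, and \<open>N\<close> is closed
  under it.\<close>

section \<open>Total properness from a closure operation on the poset\<close>

text \<open>Elementarity goes down for the existential formula and up again for the witness. Beyond
  \<open>N \<subseteq> M\<close>, this is the only form in which elementarity of \<open>N\<close> is
  used.\<close>

lemma elementary_submodel_witness:
  assumes N: "elementary_submodel N M E" and s: "\<And>i. s i \<in> N" and ex: "sat M E s (FEx i \<phi>)"
  shows "\<exists>a\<in>N. sat M E (s(i := a)) \<phi>"
proof -
  have "sat N E s (FEx i \<phi>)"
    using N s ex unfolding elementary_submodel_def by (meson image_subsetI)
  then obtain a where a: "a \<in> N" "sat N E (s(i := a)) \<phi>" by auto
  have "range (s(i := a)) \<subseteq> N" using s a(1) by auto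
  then have "sat M E (s(i := a)) \<phi>"
    using N a(2) unfolding elementary_submodel_def by blast
  then show ?thesis using a(1) by blast
qed

section \<open>First-order formulas for pairs, countability, closure and genericity\<close>

definition FAll :: "nat \<Rightarrow> set_fm \<Rightarrow> set_fm" where
  "FAll i \<phi> = FNeg (FEx i (FNeg \<phi>))"

definition FImp :: "set_fm \<Rightarrow> set_fm \<Rightarrow> set_fm" where
  "FImp \<phi> \<psi> = FNeg (FConj \<phi> (FNeg \<psi>))"

definition FOr :: "set_fm \<Rightarrow> set_fm \<Rightarrow> set_fm" where
  "FOr \<phi> \<psi> = FImp (FNeg \<phi>) \<psi>"

definition FIff :: "set_fm \<Rightarrow> set_fm \<Rightarrow> set_fm" where
  "FIff \<phi> \<psi> = FConj (FImp \<phi> \<psi>) (FImp \<psi> \<phi>)"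

lemma sat_derived [simp]:
  "sat M E s (FAll i \<phi>) \<longleftrightarrow> (\<forall>a\<in>M. sat M E (s(i := a)) \<phi>)"
  "sat M E s (FImp \<phi> \<psi>) \<longleftrightarrow> (sat M E s \<phi> \<longrightarrow> sat M E s \<psi>)"
  "sat M E s (FOr \<phi> \<psi>) \<longleftrightarrow> (sat M E s \<phi> \<or> sat M E s \<psi>)"
  "sat M E s (FIff \<phi> \<psi>) \<longleftrightarrow> (sat M E s \<phi> \<longleftrightarrow> sat M E s \<psi>)"
  by (auto simp: FAll_def FImp_def FOr_def FIff_def)

text \<open>The bound variables 90, 91, 92 must differ from the arguments.\<close>

definition fm_pair :: "nat \<Rightarrow> nat \<Rightarrow> nat \<Rightarrow> set_fm" where
  "fm_pair z x y = FEx 90 (FEx 91 (FConj (FAll 92 (FIff (FMem 92 90) (FEq 92 x)))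
     (FConj (FAll 92 (FIff (FMem 92 91) (FOr (FEq 92 x) (FEq 92 y))))
            (FAll 92 (FIff (FMem 92 z) (FOr (FEq 92 90) (FEq 92 91)))))))"

text \<open>Each \<open>fo_\<close> predicate is the literal meaning over \<open>M\<close> of the
  \<open>fm_\<close> formula of the same name, so that the simp rules for \<open>sat\<close> replace
  formulas by quantification over \<open>M\<close>.\<close>

definition fo_pair :: "'m set \<Rightarrow> ('m \<Rightarrow> 'm \<Rightarrow> bool) \<Rightarrow> 'm \<Rightarrow> 'm \<Rightarrow> 'm \<Rightarrow> bool" where
  "fo_pair M E z x y \<longleftrightarrow> (\<exists>u\<in>M. \<exists>w\<in>M. (\<forall>t\<in>M. E t u \<longleftrightarrow> t = x) \<and>
     (\<forall>t\<in>M. E t w \<longleftrightarrow> t = x \<or> t = y) \<and> (\<forall>t\<in>M. E t z \<longleftrightarrow> t = u \<or> t = w))"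

lemma sat_fm_pair [simp]:
  "z < 90 \<Longrightarrow> x < 90 \<Longrightarrow> y < 90 \<Longrightarrow>
    sat M E s (fm_pair z x y) \<longleftrightarrow> fo_pair M E (s z) (s x) (s y)"
  by (simp add: fm_pair_def fo_pair_def)

lemma fo_pair_iff: "x \<in> M \<Longrightarrow> y \<in> M \<Longrightarrow> fo_pair M E z x y \<longleftrightarrow> is_pair M E z x y"
  unfolding fo_pair_def is_pair_def mems_def set_eq_iff
  by (intro bex_cong refl) auto

definition fo_functional :: "'m set \<Rightarrow> ('m \<Rightarrow> 'm \<Rightarrow> bool) \<Rightarrow> 'm \<Rightarrow> bool" where
  "fo_functional M E f \<longleftrightarrow> (\<forall>a\<in>M. \<forall>b\<in>M. \<forall>x\<in>M. \<forall>y\<in>M. \<forall>z\<in>M.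
     E a f \<and> E b f \<and> fo_pair M E a x y \<and> fo_pair M E b x z \<longrightarrow> y = z)"

text \<open>Bound variables are layered to avoid capture: 90 to 92 for pairs, then the 80s, 70s, 60s
  and 50s. A formula passes only smaller numbers to the formulas it is built from.\<close>

definition fm_functional :: "nat \<Rightarrow> set_fm" where
  "fm_functional f = FAll 80 (FAll 81 (FAll 82 (FAll 83 (FAll 84
     (FImp (FConj (FMem 80 f) (FConj (FMem 81 f) (FConj (fm_pair 80 82 83) (fm_pair 81 82 84))))
        (FEq 83 84))))))"

lemma sat_fm_functional [simp]:
  "f < 80 \<Longrightarrow> sat M E s (fm_functional f) \<longleftrightarrow> fo_functional M E (s f)"
  by (simp add: fm_functional_def fo_functional_def)

text \<open>The natural numbers are coded by \<open>\<nu>\<^sub>0 = m\<close> and \<open>\<nu>\<^sub>k\<^sub>+\<^sub>1 = (\<nu>\<^sub>k, \<nu>\<^sub>k)\<close> for some fixed \<open>m\<close>;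
  a set is countable iff it is contained in the image of every inductive set under some
  function.\<close>

definition fo_inductive :: "'m set \<Rightarrow> ('m \<Rightarrow> 'm \<Rightarrow> bool) \<Rightarrow> 'm \<Rightarrow> 'm \<Rightarrow> bool" where
  "fo_inductive M E m Z \<longleftrightarrow>
     E m Z \<and> (\<forall>x\<in>M. \<forall>z\<in>M. E x Z \<and> fo_pair M E z x x \<longrightarrow> E z Z)"

definition fm_inductive :: "nat \<Rightarrow> nat \<Rightarrow> set_fm" where
  "fm_inductive m Z =
     FConj (FMem m Z) (FAll 80 (FAll 81 (FImp (FConj (FMem 80 Z) (fm_pair 81 80 80)) (FMem 81 Z))))"

lemma sat_fm_inductive [simp]:
  "m < 80 \<Longrightarrow> Z < 80 \<Longrightarrow> sat M E s (fm_inductive m Z) \<longleftrightarrow> fo_inductive M E (s m) (s Z)"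
  by (simp add: fm_inductive_def fo_inductive_def)

definition fo_countable :: "'m set \<Rightarrow> ('m \<Rightarrow> 'm \<Rightarrow> bool) \<Rightarrow> 'm \<Rightarrow> 'm \<Rightarrow> bool" where
  "fo_countable M E m n \<longleftrightarrow> (\<exists>g\<in>M. fo_functional M E g \<and>
     (\<forall>Z\<in>M. fo_inductive M E m Z \<longrightarrow>
       (\<forall>y\<in>M. E y n \<longrightarrow> (\<exists>x\<in>M. E x Z \<and> (\<exists>a\<in>M. E a g \<and> fo_pair M E a x y)))))"

definition fm_countable :: "nat \<Rightarrow> nat \<Rightarrow> set_fm" where
  "fm_countable m n = FEx 70 (FConj (fm_functional 70)
     (FAll 71 (FImp (fm_inductive m 71)
       (FAll 72 (FImp (FMem 72 n) (FEx 73 (FConj (FMem 73 71)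
          (FEx 74 (FConj (FMem 74 70) (fm_pair 74 73 72))))))))))"

lemma sat_fm_countable [simp]:
  "m < 70 \<Longrightarrow> n < 70 \<Longrightarrow> sat M E s (fm_countable m n) \<longleftrightarrow> fo_countable M E (s m) (s n)"
  by (simp add: fm_countable_def fo_countable_def)

text \<open>Closure under pairing lets one unary function \<open>F\<close> stand for functions of
  several arguments, one of them a coded natural number.\<close>

definition fo_closed :: "'m set \<Rightarrow> ('m \<Rightarrow> 'm \<Rightarrow> bool) \<Rightarrow> 'm \<Rightarrow> 'm \<Rightarrow> bool" where
  "fo_closed M E F n \<longleftrightarrow>
     (\<forall>x\<in>M. \<forall>y\<in>M. \<forall>z\<in>M. E x n \<and> E y n \<and> fo_pair M E z x y \<longrightarrow> E z n) \<and>
     (\<forall>x\<in>M. \<forall>y\<in>M. \<forall>z\<in>M. E x n \<and> E z F \<and> fo_pair M E z x y \<longrightarrow> E y n)"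

definition fm_closed :: "nat \<Rightarrow> nat \<Rightarrow> set_fm" where
  "fm_closed F n = FConj
     (FAll 70 (FAll 71 (FAll 72
       (FImp (FConj (FMem 70 n) (FConj (FMem 71 n) (fm_pair 72 70 71))) (FMem 72 n)))))
     (FAll 70 (FAll 71 (FAll 72
       (FImp (FConj (FMem 70 n) (FConj (FMem 72 F) (fm_pair 72 70 71))) (FMem 71 n)))))"

lemma sat_fm_closed [simp]:
  "F < 70 \<Longrightarrow> n < 70 \<Longrightarrow> sat M E s (fm_closed F n) \<longleftrightarrow> fo_closed M E (s F) (s n)"
  by (simp add: fm_closed_def fo_closed_def)

definition fo_le :: "'m set \<Rightarrow> ('m \<Rightarrow> 'm \<Rightarrow> bool) \<Rightarrow> 'm \<Rightarrow> 'm \<Rightarrow> 'm \<Rightarrow> bool" where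
  "fo_le M E mL x y \<longleftrightarrow> (\<exists>z\<in>M. E z mL \<and> fo_pair M E z x y)"

definition fm_le :: "nat \<Rightarrow> nat \<Rightarrow> nat \<Rightarrow> set_fm" where
  "fm_le mL x y = FEx 80 (FConj (FMem 80 mL) (fm_pair 80 x y))"

lemma sat_fm_le [simp]:
  "mL < 80 \<Longrightarrow> x < 80 \<Longrightarrow> y < 80 \<Longrightarrow> sat M E s (fm_le mL x y) \<longleftrightarrow> fo_le M E (s mL) (s x) (s y)"
  by (simp add: fm_le_def fo_le_def)

definition fo_dense :: "'m set \<Rightarrow> ('m \<Rightarrow> 'm \<Rightarrow> bool) \<Rightarrow> 'm \<Rightarrow> 'm \<Rightarrow> 'm \<Rightarrow> bool" where
  "fo_dense M E mP mL d \<longleftrightarrow> (\<forall>x\<in>M. E x d \<longrightarrow> E x mP) \<and>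
     (\<forall>x\<in>M. E x mP \<longrightarrow> (\<exists>y\<in>M. E y d \<and> fo_le M E mL y x))"

definition fm_dense :: "nat \<Rightarrow> nat \<Rightarrow> nat \<Rightarrow> set_fm" where
  "fm_dense mP mL d = FConj (FAll 70 (FImp (FMem 70 d) (FMem 70 mP)))
     (FAll 70 (FImp (FMem 70 mP) (FEx 71 (FConj (FMem 71 d) (fm_le mL 71 70)))))"

lemma sat_fm_dense [simp]:
  "mP < 70 \<Longrightarrow> mL < 70 \<Longrightarrow> d < 70 \<Longrightarrow>
    sat M E s (fm_dense mP mL d) \<longleftrightarrow> fo_dense M E (s mP) (s mL) (s d)"
  by (simp add: fm_dense_def fo_dense_def)

text \<open>A chain takes the place of a decreasing sequence, so no function on the natural numbers
  has to be coded; \<open>generic_sequence\<close> extracts a sequence from it.\<close>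

definition fo_generic ::
  "'m set \<Rightarrow> ('m \<Rightarrow> 'm \<Rightarrow> bool) \<Rightarrow> 'm \<Rightarrow> 'm \<Rightarrow> 'm \<Rightarrow> 'm \<Rightarrow> bool" where
  "fo_generic M E mP mL n Z \<longleftrightarrow>
     (\<forall>x\<in>M. E x Z \<longrightarrow> E x n \<and> E x mP) \<and>
     (\<forall>x\<in>M. \<forall>y\<in>M. E x Z \<and> E y Z \<longrightarrow> fo_le M E mL x y \<or> fo_le M E mL y x) \<and>
     (\<forall>d\<in>M. E d n \<and> fo_dense M E mP mL d \<longrightarrow> (\<exists>x\<in>M. E x d \<and> E x Z)) \<and>
     (\<exists>q\<in>M. E q mP \<and> (\<forall>x\<in>M. E x Z \<longrightarrow> fo_le M E mL q x))"

definition fm_generic :: "nat \<Rightarrow> nat \<Rightarrow> nat \<Rightarrow> nat \<Rightarrow> set_fm" where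
  "fm_generic mP mL n Z = FConj
     (FAll 60 (FImp (FMem 60 Z) (FConj (FMem 60 n) (FMem 60 mP)))) (FConj
     (FAll 60 (FAll 61 (FImp (FConj (FMem 60 Z) (FMem 61 Z)) (FOr (fm_le mL 60 61) (fm_le mL 61 60))))) (FConj
     (FAll 60 (FImp (FConj (FMem 60 n) (fm_dense mP mL 60)) (FEx 61 (FConj (FMem 61 60) (FMem 61 Z)))))
     (FEx 60 (FConj (FMem 60 mP) (FAll 61 (FImp (FMem 61 Z) (fm_le mL 60 61)))))))"

lemma sat_fm_generic [simp]:
  "mP < 60 \<Longrightarrow> mL < 60 \<Longrightarrow> n < 60 \<Longrightarrow> Z < 60 \<Longrightarrow>
    sat M E s (fm_generic mP mL n Z) \<longleftrightarrow> fo_generic M E (s mP) (s mL) (s n) (s Z)"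
  by (simp add: fm_generic_def fo_generic_def)

text \<open>This is the function \<open>F\<close> of the overview. The clause \<open>E m n\<close>
  puts all coded numbers into a closed \<open>n\<close>, and \<open>E mP n\<close> makes the whole
  poset one of the dense sets in \<open>n\<close>.\<close>

definition fo_guide ::
  "'m set \<Rightarrow> ('m \<Rightarrow> 'm \<Rightarrow> bool) \<Rightarrow> 'm \<Rightarrow> 'm \<Rightarrow> 'm \<Rightarrow> 'm \<Rightarrow> bool" where
  "fo_guide M E m mP mL F \<longleftrightarrow> fo_functional M E F \<and>
     (\<forall>n\<in>M. fo_countable M E m n \<and> E m n \<and> E mP n \<and> fo_closed M E F n \<longrightarrow>
       (\<forall>p\<in>M. E p n \<and> E p mP \<longrightarrow> (\<exists>Z\<in>M. E p Z \<and> fo_generic M E mP mL n Z)))"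

definition fm_guide :: "nat \<Rightarrow> nat \<Rightarrow> nat \<Rightarrow> nat \<Rightarrow> set_fm" where
  "fm_guide m mP mL F = FConj (fm_functional F)
     (FAll 50 (FImp (FConj (fm_countable m 50) (FConj (FMem m 50) (FConj (FMem mP 50) (fm_closed F 50))))
       (FAll 51 (FImp (FConj (FMem 51 50) (FMem 51 mP))
          (FEx 52 (FConj (FMem 51 52) (fm_generic mP mL 50 52)))))))"

lemma sat_fm_guide [simp]:
  "m < 50 \<Longrightarrow> mP < 50 \<Longrightarrow> mL < 50 \<Longrightarrow> F < 50 \<Longrightarrow>
    sat M E s (fm_guide m mP mL F) \<longleftrightarrow> fo_guide M E (s m) (s mP) (s mL) (s F)"
  by (simp add: fm_guide_def fo_guide_def)

section \<open>Small sets, pairs and numerals inside H(\<lambda>)\<close>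

locale H_model =
  fixes lam :: "'m rel" and M :: "'m set" and E :: "'m \<Rightarrow> 'm \<Rightarrow> bool"
  assumes card_lam: "Card_order lam" and regular_lam: "regularCard lam"
    and uncountable_lam: "natLeq <o lam" and H_structure: "H_structure lam M E"
begin

lemma Cinfinite_lam: "Cinfinite lam"
  using card_lam uncountable_lam natLeq_Cinfinite cinfinite_mono ordLess_imp_ordLeq by blast

lemma countable_small: "countable S \<Longrightarrow> |S| <o lam"
  using uncountable_lam countable_card_le_natLeq ordLeq_ordLess_trans by blast

lemma small_subset: "A \<subseteq> B \<Longrightarrow> |B| <o lam \<Longrightarrow> |A| <o lam"
  using card_of_mono1 ordLeq_ordLess_trans by blast

lemma small_image: "|B| <o lam \<Longrightarrow> |f ` B| <o lam"
  using card_of_image ordLeq_ordLess_trans by blast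

lemma small_UNION: "|I| <o lam \<Longrightarrow> (\<And>i. i \<in> I \<Longrightarrow> |A i| <o lam) \<Longrightarrow> |\<Union>i\<in>I. A i| <o lam"
  by (intro card_of_UNION_ordLess_infinite_Field_regularCard[OF regular_lam Cinfinite_lam] ballI)

lemma small_Times: "|A| <o lam \<Longrightarrow> |B| <o lam \<Longrightarrow> |A \<times> B| <o lam"
proof -
  assume "|A| <o lam" "|B| <o lam"
  then have "|\<Union>a\<in>A. Pair a ` B| <o lam"
    by (intro small_UNION small_image)
  moreover have "(\<Union>a\<in>A. Pair a ` B) = A \<times> B" by auto
  ultimately show ?thesis by simp
qed

lemma mems_ext: "x \<in> M \<Longrightarrow> y \<in> M \<Longrightarrow> mems M E x = mems M E y \<Longrightarrow> x = y"
  using H_structure unfolding H_structure_def inj_on_def by blast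

text \<open>\<open>H_structure\<close> bounds the closure of the extension of \<open>x\<close>.
  Adding \<open>x\<close> itself suffices, as the last step of a membership path to \<open>x\<close>
  starts from a member of \<open>x\<close>.\<close>

lemma small_transitive_closure:
  assumes "x \<in> M"
  shows "|((mem_rel M E)\<^sup>*)\<inverse> `` {x}| <o lam"
proof -
  let ?r = "mem_rel M E"
  have "mems M E x \<subseteq> M" by (auto simp: mems_def)
  then have "|(?r\<^sup>*)\<inverse> `` mems M E x| <o lam"
    using H_structure assms unfolding H_structure_def by blast
  moreover have "|{x}| <o lam" by (rule countable_small) simp
  ultimately have "|{x} \<union> (?r\<^sup>*)\<inverse> `` mems M E x| <o lam"
    using Cinfinite_lam card_of_Un_ordLess_infinite_Field unfolding cinfinite_def by blast
  moreover have "(?r\<^sup>*)\<inverse> `` {x} \<subseteq> {x} \<union> (?r\<^sup>*)\<inverse> `` mems M E x"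
  proof
    fix y assume "y \<in> (?r\<^sup>*)\<inverse> `` {x}"
    then have "(y, x) \<in> ?r\<^sup>*" by simp
    then show "y \<in> {x} \<union> (?r\<^sup>*)\<inverse> `` mems M E x"
    proof (cases rule: rtranclE)
      case (step z)
      then have "z \<in> mems M E x" by (simp add: mem_rel_def mems_def)
      then show ?thesis using step by blast
    qed simp
  qed
  ultimately show ?thesis using small_subset by blast
qed

text \<open>By regularity of \<open>lam\<close>, a union of fewer than \<open>lam\<close> small
  transitive closures is small. From here on cardinality alone decides which subsets of
  \<open>M\<close> are elements.\<close>

lemma ex_set:
  assumes "S \<subseteq> M" "|S| <o lam"
  shows "\<exists>m\<in>M. mems M E m = S"
proof -
  let ?T = "\<lambda>x. ((mem_rel M E)\<^sup>*)\<inverse> `` {x}"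
  have "|\<Union>x\<in>S. ?T x| <o lam"
    by (rule small_UNION[OF assms(2) small_transitive_closure]) (use assms(1) in blast)
  moreover have "(\<Union>x\<in>S. ?T x) = ((mem_rel M E)\<^sup>*)\<inverse> `` S"
    by (rule Image_eq_UN[symmetric])
  ultimately have "|((mem_rel M E)\<^sup>*)\<inverse> `` S| <o lam" by simp
  then show ?thesis
    using H_structure assms(1) unfolding H_structure_def by blast
qed

definition mk :: "'m set \<Rightarrow> 'm" where
  "mk S = (SOME m. m \<in> M \<and> mems M E m = S)"

lemma mk:
  assumes "S \<subseteq> M" "|S| <o lam"
  shows "mk S \<in> M" "mems M E (mk S) = S"
  using someI_ex[of "\<lambda>m. m \<in> M \<and> mems M E m = S"] ex_set[OF assms] unfolding mk_def by blast+

lemma mk_mem: "S \<subseteq> M \<Longrightarrow> |S| <o lam \<Longrightarrow> x \<in> M \<Longrightarrow> E x (mk S) \<longleftrightarrow> x \<in> S"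
  using mk(2)[of S] unfolding mems_def by blast

definition pr :: "'m \<Rightarrow> 'm \<Rightarrow> 'm" where
  "pr x y = mk {mk {x}, mk {x, y}}"

lemma pr:
  assumes "x \<in> M" "y \<in> M"
  shows "pr x y \<in> M" "is_pair M E (pr x y) x y" "E (mk {x}) (pr x y)" "E x (mk {x})"
proof -
  have fin: "finite S \<Longrightarrow> |S| <o lam" for S :: "'m set"
    by (simp add: countable_small countable_finite)
  have 1: "mk {x} \<in> M" "mems M E (mk {x}) = {x}" using assms by (auto intro!: mk fin)
  have 2: "mk {x, y} \<in> M" "mems M E (mk {x, y}) = {x, y}" using assms by (auto intro!: mk fin)
  have 3: "pr x y \<in> M" "mems M E (pr x y) = {mk {x}, mk {x, y}}"
    using 1 2 unfolding pr_def by (auto intro!: mk fin)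
  show "pr x y \<in> M" by (rule 3)
  show "is_pair M E (pr x y) x y" unfolding is_pair_def using 1 2 3 by blast
  show "E (mk {x}) (pr x y)" "E x (mk {x})" using 1(2) 3(2) unfolding mems_def by blast+
qed

text \<open>Taking extensions twice turns \<open>z\<close> into the Kuratowski pair of genuine HOL
  sets.\<close>

lemma is_pair_cong:
  assumes "is_pair M E z x y" "is_pair M E z x' y'"
  shows "x = x' \<and> y = y'"
proof -
  have "mems M E ` mems M E z = {{x}, {x, y}}" if "is_pair M E z x y" for x y
    using that unfolding is_pair_def by auto
  from this[OF assms(1)] this[OF assms(2)] have "{{x}, {x, y}} = {{x'}, {x', y'}}" by simp
  then show ?thesis by (auto simp: doubleton_eq_iff)
qed

lemma is_pair_unique:
  assumes "is_pair M E z x y" "is_pair M E z' x y" "z \<in> M" "z' \<in> M"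
  shows "z = z'"
proof -
  obtain u w where "u \<in> M" "w \<in> M" "mems M E u = {x}" "mems M E w = {x, y}" "mems M E z = {u, w}"
    using assms(1) unfolding is_pair_def by blast
  moreover obtain u' w' where
    "u' \<in> M" "w' \<in> M" "mems M E u' = {x}" "mems M E w' = {x, y}" "mems M E z' = {u', w'}"
    using assms(2) unfolding is_pair_def by blast
  ultimately show ?thesis using mems_ext assms(3,4) by metis
qed

lemma fo_pair_pr:
  "x \<in> M \<Longrightarrow> y \<in> M \<Longrightarrow> z \<in> M \<Longrightarrow> fo_pair M E z x y \<longleftrightarrow> z = pr x y"
  using fo_pair_iff is_pair_unique pr(1,2) by metis

lemma pr_inject:
  "x \<in> M \<Longrightarrow> y \<in> M \<Longrightarrow> x' \<in> M \<Longrightarrow> y' \<in> M \<Longrightarrow> pr x y = pr x' y' \<longleftrightarrow> x = x' \<and> y = y'"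
  using is_pair_cong pr(2) by metis

primrec num :: "'m \<Rightarrow> nat \<Rightarrow> 'm" where
  "num m 0 = m"
| "num m (Suc k) = pr (num m k) (num m k)"

lemma num_in: "m \<in> M \<Longrightarrow> num m k \<in> M"
  by (induction k) (auto simp: pr)

text \<open>A numeral is a member of its singleton, which is a member of the next numeral. So
  numerals climb along membership, and well-foundedness keeps them distinct.\<close>

lemma num_trancl:
  assumes "m \<in> M"
  shows "(num m k, num m (Suc (k + l))) \<in> (mem_rel M E)\<^sup>+"
proof -
  have step: "(num m k, num m (Suc k)) \<in> (mem_rel M E)\<^sup>+" for k
  proof -
    let ?x = "num m k"
    have x: "?x \<in> M" using num_in assms by blast
    have "mk {?x} \<in> M" using mk(1)[of "{?x}"] x countable_small[of "{?x}"] by auto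
    then have "(?x, mk {?x}) \<in> mem_rel M E" "(mk {?x}, pr ?x ?x) \<in> mem_rel M E"
      using x pr[OF x x] unfolding mem_rel_def by auto
    then show ?thesis by auto
  qed
  show ?thesis
  proof (induction l)
    case 0
    then show ?case using step by simp
  next
    case (Suc l)
    then show ?case using step[of "Suc (k + l)"] trancl_trans by (metis add_Suc_right)
  qed
qed

lemma num_inject:
  assumes "m \<in> M"
  shows "num m k = num m l \<longleftrightarrow> k = l"
proof -
  have wf: "wf ((mem_rel M E)\<^sup>+)" using H_structure wf_trancl unfolding H_structure_def by blast
  have "k < l \<Longrightarrow> num m k \<noteq> num m l" for k l
    using num_trancl[OF assms, of k "l - Suc k"] wf_not_refl[OF wf] by auto
  then show ?thesis by (metis linorder_neqE_nat)
qed

text \<open>In one direction the least inductive set \<open>range (num m)\<close> is used: each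
  \<open>y\<close> gets the index of a numeral that \<open>g\<close> sends to \<open>y\<close>, and
  functionality of \<open>g\<close> makes this injective. Conversely an enumeration yields
  \<open>g\<close>, since every inductive set contains all numerals.\<close>

lemma fo_countable_iff:
  assumes m: "m \<in> M" and n: "n \<in> M"
  shows "fo_countable M E m n \<longleftrightarrow> countable (mems M E n)"
proof
  let ?W = "range (num m)"
  have W: "?W \<subseteq> M" "|?W| <o lam" using num_in[OF m] by (auto intro: countable_small)
  assume "fo_countable M E m n"
  then obtain g where g: "g \<in> M" "fo_functional M E g"
    and *: "\<And>Z. Z \<in> M \<Longrightarrow> fo_inductive M E m Z \<Longrightarrow>
       (\<forall>y\<in>M. E y n \<longrightarrow> (\<exists>x\<in>M. E x Z \<and> (\<exists>a\<in>M. E a g \<and> fo_pair M E a x y)))"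
    unfolding fo_countable_def by blast
  have "E m (mk ?W)" using mk_mem[OF W m] num.simps(1)[of m] by (metis rangeI)
  moreover have "E (pr x x) (mk ?W)" if x: "x \<in> M" "E x (mk ?W)" for x
  proof -
    obtain k where "x = num m k" using x mk_mem[OF W] by auto
    then have "pr x x = num m (Suc k)" by simp
    then show ?thesis using mk_mem[OF W] num_in[OF m] by (metis rangeI)
  qed
  ultimately have "fo_inductive M E m (mk ?W)"
    unfolding fo_inductive_def using fo_pair_pr by auto
  from *[OF mk(1)[OF W] this]
  have "\<forall>y\<in>mems M E n. \<exists>k. E (pr (num m k) y) g"
    using mk_mem[OF W] fo_pair_pr unfolding mems_def by auto
  then obtain h where h: "\<And>y. y \<in> mems M E n \<Longrightarrow> E (pr (num m (h y)) y) g" by metis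
  have "inj_on h (mems M E n)"
  proof (rule inj_onI)
    fix x y assume xy: "x \<in> mems M E n" "y \<in> mems M E n" "h x = h y"
    then have M: "x \<in> M" "y \<in> M" by (auto simp: mems_def)
    let ?k = "num m (h y)"
    have k: "?k \<in> M" using num_in m by blast
    have "E (pr ?k x) g" "E (pr ?k y) g" using h[OF xy(1)] h[OF xy(2)] xy(3) by auto
    moreover have "fo_pair M E (pr ?k x) ?k x" "fo_pair M E (pr ?k y) ?k y"
      using M k fo_pair_pr pr(1) by auto
    ultimately show "x = y"
      using g(2) M k pr(1) unfolding fo_functional_def by blast
  qed
  then show "countable (mems M E n)" using countableI by blast
next
  assume c: "countable (mems M E n)"
  let ?h = "to_nat_on (mems M E n)"
  define g where "g = (\<lambda>y. pr (num m (?h y)) y) ` mems M E n"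
  have nM: "mems M E n \<subseteq> M" by (auto simp: mems_def)
  have gM: "g \<subseteq> M" using nM num_in[OF m] pr(1) unfolding g_def by blast
  have gs: "|g| <o lam" using c countable_small unfolding g_def by blast
  note g = mk[OF gM gs] mk_mem[OF gM gs]
  have "fo_functional M E (mk g)"
    unfolding fo_functional_def
  proof (intro ballI impI, elim conjE)
    fix a b x y z assume M: "a \<in> M" "b \<in> M" "x \<in> M" "y \<in> M" "z \<in> M"
      and "E a (mk g)" "E b (mk g)" "fo_pair M E a x y" "fo_pair M E b x z"
    then have "pr x y \<in> g" "pr x z \<in> g" using g(3) fo_pair_pr by auto
    then obtain y' z' where yz: "y' \<in> mems M E n" "z' \<in> mems M E n"
      and "pr x y = pr (num m (?h y')) y'" "pr x z = pr (num m (?h z')) z'"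
      unfolding g_def by blast
    then have "x = num m (?h y')" "y = y'" "x = num m (?h z')" "z = z'"
      using pr_inject M num_in[OF m] nM by (metis subsetD)+
    then have "?h y = ?h z" using num_inject[OF m] by simp
    then show "y = z" using inj_on_to_nat_on[OF c] yz \<open>y = y'\<close> \<open>z = z'\<close> by (metis inj_onD)
  qed
  moreover have "\<exists>x\<in>M. E x Z \<and> (\<exists>a\<in>M. E a (mk g) \<and> fo_pair M E a x y)"
    if "fo_inductive M E m Z" "y \<in> M" "E y n" for Z y
  proof -
    have "E (num m k) Z" for k
    proof (induction k)
      case 0
      then show ?case using that(1) unfolding fo_inductive_def by simp
    next
      case (Suc k)
      then show ?case
        using that(1) num_in[OF m] pr(1) fo_pair_pr unfolding fo_inductive_def by simp
    qed
    moreover have "E (pr (num m (?h y)) y) (mk g)"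
    proof -
      have "y \<in> mems M E n" using that by (simp add: mems_def)
      then have "pr (num m (?h y)) y \<in> g" unfolding g_def by blast
      then show ?thesis using g(3) gM by blast
    qed
    moreover have "fo_pair M E (pr (num m (?h y)) y) (num m (?h y)) y"
      using fo_pair_pr num_in[OF m] pr(1) that(2) by simp
    ultimately show ?thesis
      using num_in[OF m] pr(1) that(2) by blast
  qed
  ultimately show "fo_countable M E m n"
    unfolding fo_countable_def using g(1) by blast
qed

end


section \<open>A poset coded in H(\<lambda>) and the existence of a guide\<close>

locale H_forcing = H_model lam M E
  for lam :: "'m rel" and M :: "'m set" and E :: "'m \<Rightarrow> 'm \<Rightarrow> bool" +
  fixes c :: "'p \<Rightarrow> 'm" and P :: "'p set" and le :: "'p \<Rightarrow> 'p \<Rightarrow> bool" and m mP mL :: 'm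
  assumes inj_c: "inj_on c P" and small_Pow: "|Pow P| <o lam"
    and m: "m \<in> M" and mP: "mP \<in> M" "mems M E mP = c ` P"
    and mL: "mL \<in> M" "mems M E mL = {z \<in> M. \<exists>p\<in>P. \<exists>q\<in>P. le p q \<and> is_pair M E z (c p) (c q)}"
begin

lemma c_in: "p \<in> P \<Longrightarrow> c p \<in> M"
  using mP(2) unfolding mems_def by blast

lemma E_mP: "x \<in> M \<Longrightarrow> E x mP \<longleftrightarrow> x \<in> c ` P"
  using mP(2) unfolding mems_def by blast

lemma fo_le_iff:
  assumes "p \<in> P" "q \<in> P"
  shows "fo_le M E mL (c p) (c q) \<longleftrightarrow> le p q"
proof -
  let ?z = "pr (c p) (c q)"
  have z: "?z \<in> M" "is_pair M E ?z (c p) (c q)" using assms c_in pr by auto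
  have "fo_le M E mL (c p) (c q) \<longleftrightarrow> E ?z mL"
    unfolding fo_le_def using assms c_in z fo_pair_pr by auto
  also have "\<dots> \<longleftrightarrow> ?z \<in> mems M E mL" using z by (simp add: mems_def)
  also have "\<dots> \<longleftrightarrow> le p q"
  proof
    assume "?z \<in> mems M E mL"
    then obtain p' q' where "p' \<in> P" "q' \<in> P" "le p' q'" "is_pair M E ?z (c p') (c q')"
      using mL(2) by blast
    then show "le p q" using is_pair_cong[OF z(2)] inj_c assms by (metis inj_onD)
  next
    assume "le p q"
    then show "?z \<in> mems M E mL" using mL(2) z assms by blast
  qed
  finally show ?thesis .
qed

lemma small_P: "|P| <o lam"
  using small_Pow card_of_Pow ordLess_transitive by blast

definition code :: "'p set \<Rightarrow> 'm" where
  "code D = mk (c ` D)"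

lemma code:
  assumes "D \<subseteq> P"
  shows "code D \<in> M" "mems M E (code D) = c ` D" "x \<in> M \<Longrightarrow> E x (code D) \<longleftrightarrow> x \<in> c ` D"
proof -
  have "c ` D \<subseteq> M" "|c ` D| <o lam"
    using assms c_in small_image[OF small_subset[OF _ small_P]] by auto
  note mk = mk[OF this] mk_mem[OF this]
  show "code D \<in> M" "mems M E (code D) = c ` D" "x \<in> M \<Longrightarrow> E x (code D) \<longleftrightarrow> x \<in> c ` D"
    unfolding code_def by (rule mk; assumption?)+
qed

lemma code_inject: "D \<subseteq> P \<Longrightarrow> D' \<subseteq> P \<Longrightarrow> code D = code D' \<longleftrightarrow> D = D'"
  using code(2) inj_on_image_eq_iff[OF inj_c] by metis

lemma E_code: "D \<subseteq> P \<Longrightarrow> p \<in> P \<Longrightarrow> E (c p) (code D) \<longleftrightarrow> p \<in> D"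
  using code(3)[OF _ c_in] inj_on_image_mem_iff[OF inj_c] by blast

lemma fo_dense_iff:
  assumes "D \<subseteq> P"
  shows "fo_dense M E mP mL (code D) \<longleftrightarrow> (\<forall>x\<in>P. \<exists>y\<in>D. le y x)"
proof -
  have "(\<exists>y\<in>M. E y (code D) \<and> fo_le M E mL y (c x)) \<longleftrightarrow> (\<exists>y\<in>D. le y x)" if x: "x \<in> P" for x
    using code(3)[OF assms] c_in fo_le_iff[OF _ x] assms by fastforce
  moreover have "E x mP" if "x \<in> M" "E x (code D)" for x
    using that code(3)[OF assms] E_mP assms by blast
  ultimately show ?thesis
    unfolding fo_dense_def using E_mP c_in by auto
qed

text \<open>Hence the dense elements of \<open>M\<close> are exactly the codes of dense sets of
  conditions.\<close>

lemma fo_dense_imp_code: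
  assumes "d \<in> M" "fo_dense M E mP mL d"
  shows "\<exists>D\<subseteq>P. d = code D"
proof -
  have "mems M E d \<subseteq> c ` P"
    using assms(2) E_mP unfolding fo_dense_def mems_def by blast
  then obtain D where D: "D \<subseteq> P" "mems M E d = c ` D" by (meson subset_imageE)
  then show ?thesis using mems_ext[OF assms(1)] code[OF D(1)] by auto
qed

definition dense :: "'p set \<Rightarrow> bool" where
  "dense D \<longleftrightarrow> D \<subseteq> P \<and> (\<forall>x\<in>P. \<exists>y\<in>D. le y x)"

lemma fo_generic_code:
  assumes "Z \<subseteq> P" "\<And>z. z \<in> Z \<Longrightarrow> E (c z) n"
    and "\<And>x y. x \<in> Z \<Longrightarrow> y \<in> Z \<Longrightarrow> le x y \<or> le y x"
    and D: "\<And>D. dense D \<Longrightarrow> E (code D) n \<Longrightarrow> D \<inter> Z \<noteq> {}"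
    and q: "q \<in> P" "\<And>x. x \<in> Z \<Longrightarrow> le q x"
  shows "fo_generic M E mP mL n (code Z)"
  unfolding fo_generic_def
proof (intro conjI ballI impI)
  fix x assume "x \<in> M" "E x (code Z)"
  then obtain z where "x = c z" "z \<in> Z" using code(3)[OF assms(1)] by blast
  then show "E x n" "E x mP" using assms(1,2) E_mP c_in by auto
next
  fix x y assume "x \<in> M" "y \<in> M" "E x (code Z) \<and> E y (code Z)"
  then obtain z w where "x = c z" "z \<in> Z" "y = c w" "w \<in> Z"
    using code(3)[OF assms(1)] by blast
  then show "fo_le M E mL x y \<or> fo_le M E mL y x"
    using assms(1,3) fo_le_iff by (metis subsetD)
next
  fix d assume d: "d \<in> M" "E d n \<and> fo_dense M E mP mL d"
  then obtain D where "D \<subseteq> P" "d = code D" using fo_dense_imp_code by blast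
  then obtain z where "z \<in> D" "z \<in> Z"
    using D d fo_dense_iff unfolding dense_def by blast
  then show "\<exists>x\<in>M. E x d \<and> E x (code Z)"
    using E_code \<open>D \<subseteq> P\<close> \<open>d = code D\<close> assms(1) c_in by blast
next
  have "fo_le M E mL (c q) x" if "x \<in> M" "E x (code Z)" for x
    using that code(3)[OF assms(1)] q assms(1) fo_le_iff by blast
  then show "\<exists>q\<in>M. E q mP \<and> (\<forall>x\<in>M. E x (code Z) \<longrightarrow> fo_le M E mL q x)"
    using q(1) c_in E_mP by blast
qed

text \<open>The guide sends the code of \<open>(p, r, D)\<close> paired with the numeral of k to the
  k-th element of \<open>A p r D\<close>. A set closed under it and under pairing then absorbs
  \<open>A p r D\<close> for all of its own \<open>p\<close>, \<open>r\<close>, \<open>D\<close>,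
  which is what \<open>gen\<close> asks for.\<close>

lemma ex_guide:
  fixes A :: "'p \<Rightarrow> 'p \<Rightarrow> 'p set \<Rightarrow> 'p set"
  assumes refl: "\<And>p. p \<in> P \<Longrightarrow> le p p"
    and A: "\<And>p r D. p \<in> P \<Longrightarrow> r \<in> P \<Longrightarrow> D \<subseteq> P \<Longrightarrow> countable (A p r D) \<and> A p r D \<subseteq> P"
    and gen: "\<And>Q \<D> p. countable Q \<Longrightarrow> countable \<D> \<Longrightarrow> Q \<subseteq> P \<Longrightarrow> P \<in> \<D> \<Longrightarrow> (\<And>D. D \<in> \<D> \<Longrightarrow> dense D) \<Longrightarrow>
      (\<And>p r D. p \<in> Q \<Longrightarrow> r \<in> Q \<Longrightarrow> D \<in> \<D> \<Longrightarrow> A p r D \<subseteq> Q) \<Longrightarrow> p \<in> Q \<Longrightarrow>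
      \<exists>Z\<subseteq>Q. p \<in> Z \<and> (\<forall>x\<in>Z. \<forall>y\<in>Z. le x y \<or> le y x) \<and> (\<forall>D\<in>\<D>. D \<inter> Z \<noteq> {}) \<and>
        (\<exists>q\<in>P. \<forall>x\<in>Z. le q x)"
  shows "\<exists>F\<in>M. fo_guide M E m mP mL F"
proof -
  define t where "t = (\<lambda>p r D. pr (c p) (pr (c r) (code D)))"
  \<comment> \<open>Triples with empty value are left out so that \<open>from_nat_into\<close>
    really enumerates \<open>A p r D\<close>.\<close>
  define I where "I = {(p, r, D). p \<in> P \<and> r \<in> P \<and> D \<subseteq> P \<and> A p r D \<noteq> {}}"
  define pt where "pt = (\<lambda>((p, r, D), k). pr (pr (t p r D) (num m k)) (c (from_nat_into (A p r D) k)))"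
  define F where "F = pt ` (I \<times> UNIV)"
  have t_in: "t p r D \<in> M" if "p \<in> P" "r \<in> P" "D \<subseteq> P" for p r D
    unfolding t_def using that c_in code(1) pr(1) by simp
  have A_in: "from_nat_into (A p r D) k \<in> A p r D" "from_nat_into (A p r D) k \<in> P"
    if "(p, r, D) \<in> I" for p r D k
    using that A from_nat_into[of "A p r D" k] unfolding I_def by auto
  have pt_in: "pr (t p r D) (num m k) \<in> M" "c (from_nat_into (A p r D) k) \<in> M"
    "pt ((p, r, D), k) \<in> M" if "(p, r, D) \<in> I" for p r D k
    using that A_in(2)[OF that] t_in num_in[OF m] c_in pr(1) unfolding I_def pt_def by auto
  have FM: "F \<subseteq> M" using pt_in(3) unfolding F_def by auto
  \<comment> \<open>The bound on \<open>Pow P\<close> makes the set of triples small, hence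
    \<open>F\<close> an element of \<open>M\<close>.\<close>
  have "I \<subseteq> P \<times> P \<times> Pow P" unfolding I_def by auto
  then have "|I| <o lam"
    using small_subset small_Times[OF small_P small_Times[OF small_P small_Pow]] by blast
  then have Fs: "|F| <o lam"
    unfolding F_def by (intro small_image small_Times[OF _ countable_small]) simp_all
  note F = mk[OF FM Fs] mk_mem[OF FM Fs]
  have functional: "fo_functional M E (mk F)"
    unfolding fo_functional_def
  proof (intro ballI impI, elim conjE)
    fix a b x y z assume M: "a \<in> M" "b \<in> M" "x \<in> M" "y \<in> M" "z \<in> M"
      and "E a (mk F)" "E b (mk F)" "fo_pair M E a x y" "fo_pair M E b x z"
    then have "pr x y \<in> F" "pr x z \<in> F" using F(3) fo_pair_pr by auto
    then obtain p r D k p' r' D' k' where I: "(p, r, D) \<in> I" "(p', r', D') \<in> I"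
      and eq: "pr x y = pt ((p, r, D), k)" "pr x z = pt ((p', r', D'), k')"
      unfolding F_def by auto
    have 1: "x = pr (t p r D) (num m k)" "y = c (from_nat_into (A p r D) k)"
      using eq(1) pt_in[OF I(1)] M pr_inject unfolding pt_def by auto
    have 2: "x = pr (t p' r' D') (num m k')" "z = c (from_nat_into (A p' r' D') k')"
      using eq(2) pt_in[OF I(2)] M pr_inject unfolding pt_def by auto
    have P: "p \<in> P" "r \<in> P" "D \<subseteq> P" "p' \<in> P" "r' \<in> P" "D' \<subseteq> P" using I unfolding I_def by auto
    have "t p r D = t p' r' D'" "num m k = num m k'"
      using 1(1) 2(1) pr_inject t_in P num_in[OF m] by metis+
    then have "c p = c p'" "c r = c r'" "code D = code D'" "k = k'"
      using pr_inject pr(1) c_in code(1) P num_inject[OF m] unfolding t_def by simp_all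
    then have "p = p'" "r = r'" "D = D'" "k = k'"
      using P inj_c code_inject by (auto dest: inj_onD)
    then show "y = z" using 1 2 by simp
  qed
  have "\<exists>Z\<in>M. E x Z \<and> fo_generic M E mP mL n Z"
    if n: "n \<in> M" "fo_countable M E m n" "E m n" "E mP n" "fo_closed M E (mk F) n"
      and x: "x \<in> M" "E x n" "E x mP" for n x
  proof -
    obtain p where p: "p \<in> P" "x = c p" using x E_mP by blast
    \<comment> \<open>The conditions and the dense sets that \<open>n\<close> contains.\<close>
    define Q where "Q = {p \<in> P. E (c p) n}"
    define \<D> where "\<D> = {D. dense D \<and> E (code D) n}"
    have cn: "countable (mems M E n)" using fo_countable_iff[OF m n(1)] n(2) by simp
    have "c ` Q \<subseteq> mems M E n" unfolding Q_def mems_def using c_in by auto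
    then have "countable (c ` Q)" using cn countable_subset by blast
    then have "countable Q"
      by (rule countable_image_inj_on) (use inj_c in \<open>auto simp: Q_def inj_on_def\<close>)
    moreover have "countable \<D>"
    proof -
      have 1: "code ` \<D> \<subseteq> mems M E n" unfolding \<D>_def mems_def dense_def using code(1) by auto
      have 2: "inj_on code \<D>"
        unfolding \<D>_def dense_def by (auto intro!: inj_onI simp: code_inject)
      show ?thesis by (rule countable_image_inj_on[OF countable_subset[OF 1 cn] 2])
    qed
    moreover have "Q \<subseteq> P" unfolding Q_def by blast
    moreover have "P \<in> \<D>"
    proof -
      \<comment> \<open>By extensionality; so \<open>P\<close> can always serve as the third
        argument of \<open>A\<close> where only the conditions matter.\<close>
      have "code P = mP" using mems_ext[OF code(1) mP(1)] code(2) mP(2) by simp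
      then show ?thesis using n(4) refl unfolding \<D>_def dense_def by auto
    qed
    moreover have "\<And>D. D \<in> \<D> \<Longrightarrow> dense D" unfolding \<D>_def by blast
    moreover have "A p r D \<subseteq> Q" if prD: "p \<in> Q" "r \<in> Q" "D \<in> \<D>" for p r D
    proof
      fix y assume y: "y \<in> A p r D"
      have P: "p \<in> P" "r \<in> P" "D \<subseteq> P" and I: "(p, r, D) \<in> I"
        using prD y unfolding Q_def \<D>_def dense_def I_def by auto
      have pair: "E (pr u w) n" if uw: "u \<in> M" "w \<in> M" "E u n" "E w n" for u w
      proof -
        have "pr u w \<in> M" "fo_pair M E (pr u w) u w" using uw fo_pair_pr pr(1) by auto
        then show ?thesis using uw n(5) unfolding fo_closed_def by blast
      qed
      have num: "E (num m k) n" for k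
        by (induction k) (auto simp: n(3) pair num_in[OF m])
      have "E (t p r D) n"
        using prD P c_in code(1) pr(1) pair unfolding t_def Q_def \<D>_def by auto
      moreover obtain k where k: "y = from_nat_into (A p r D) k"
        using from_nat_into_surj y A[OF P] by metis
      ultimately have 1: "E (pr (t p r D) (num m k)) n"
        using pair num num_in[OF m] t_in P by blast
      have "pt ((p, r, D), k) \<in> F" unfolding F_def using I by blast
      then have 2: "E (pt ((p, r, D), k)) (mk F)" using F(3)[OF pt_in(3)[OF I]] by blast
      have 3: "fo_pair M E (pt ((p, r, D), k)) (pr (t p r D) (num m k)) (c y)"
        using fo_pair_pr[OF pt_in(1,2,3)[OF I, of k]] k unfolding pt_def by simp
      have "c y \<in> M" using pt_in(2)[OF I, of k] k by simp
      then have "E (c y) n"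
        using n(5) 1 2 3 pt_in(1,3)[OF I, of k] unfolding fo_closed_def by blast
      then show "y \<in> Q" using A[OF P] y unfolding Q_def by blast
    qed
    moreover have "p \<in> Q" using p x unfolding Q_def by blast
    ultimately obtain Z q where Z: "Z \<subseteq> Q" "p \<in> Z" "\<And>x y. x \<in> Z \<Longrightarrow> y \<in> Z \<Longrightarrow> le x y \<or> le y x"
      "\<And>D. D \<in> \<D> \<Longrightarrow> D \<inter> Z \<noteq> {}" "q \<in> P" "\<And>x. x \<in> Z \<Longrightarrow> le q x"
      using gen[of Q \<D> p] by metis
    have ZP: "Z \<subseteq> P" using Z(1) \<open>Q \<subseteq> P\<close> by blast
    have "fo_generic M E mP mL n (code Z)"
    proof (rule fo_generic_code[OF ZP _ Z(3) _ Z(5,6)])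
      show "\<And>z. z \<in> Z \<Longrightarrow> E (c z) n" using Z(1) unfolding Q_def by blast
      show "\<And>D. dense D \<Longrightarrow> E (code D) n \<Longrightarrow> D \<inter> Z \<noteq> {}" using Z(4) unfolding \<D>_def by blast
    qed
    moreover have "E x (code Z)" using E_code[OF ZP p(1)] p(2) Z(2) by simp
    ultimately show ?thesis using code(1)[OF ZP] by blast
  qed
  then have "fo_guide M E m mP mL (mk F)"
    unfolding fo_guide_def using functional by blast
  then show ?thesis using F(1) by blast
qed

text \<open>From \<open>m\<close> alone elementarity yields \<open>mP\<close> and \<open>mL\<close>
  in \<open>N\<close>, then a guide in \<open>N\<close>, and closure of \<open>N\<close> under
  pairing and the guide. Being a countable subset of \<open>M\<close>, \<open>N\<close> is coded by
  an element of \<open>M\<close>, to which the guide applies.\<close>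

lemma generic_sequence:
  assumes N: "countable N" "elementary_submodel N M E" "m \<in> N"
    and pair: "is_pair M E m mP mL"
    and guide: "\<exists>F\<in>M. fo_guide M E m mP mL F"
    and p: "p \<in> P" "c p \<in> N"
  shows "\<exists>s. s 0 = p \<and> (\<forall>n. s n \<in> P \<and> c (s n) \<in> N \<and> le (s (Suc n)) (s n)) \<and>
    (\<forall>D. dense_open P le D \<and> (\<exists>d\<in>N. mems M E d = c ` D) \<longrightarrow> (\<exists>n. s n \<in> D)) \<and>
    (\<exists>q\<in>P. \<forall>n. le q (s n))"
proof -
  have NM: "N \<subseteq> M" using N(2) unfolding elementary_submodel_def by blast
  note witness = elementary_submodel_witness[OF N(2)]
  \<comment> \<open>Every variable gets the default \<open>m\<close>, so that valuations stay inside
    \<open>N\<close>.\<close>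
  define s0 where "s0 = (\<lambda>_::nat. m)"
  have pair_closed: "pr x y \<in> N" if xyN: "x \<in> N" "y \<in> N" for x y
  proof -
    have xy: "x \<in> M" "y \<in> M" using xyN NM by auto
    have sN: "(s0(1 := x, 2 := y)) i \<in> N" for i
      using N(3) xyN by (simp add: s0_def)
    have "sat M E (s0(1 := x, 2 := y)) (FEx 0 (fm_pair 0 1 2))"
      using xy pr(1)[OF xy] fo_pair_pr by auto
    from witness[OF sN this] obtain z where "z \<in> N" "fo_pair M E z x y"
      using N(3) xyN by (auto simp: s0_def)
    then show ?thesis using fo_pair_pr xy NM by auto
  qed
  have mPL: "fo_pair M E m mP mL" using fo_pair_iff[OF mP(1) mL(1)] pair by blast
  have "mP \<in> N"
  proof -
    have sN: "s0 i \<in> N" for i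
      using N(3) by (simp add: s0_def)
    have "sat M E s0 (FEx 1 (FEx 2 (fm_pair 0 1 2)))"
      using mPL mP(1) mL(1) by (auto simp: s0_def)
    from witness[OF sN this] obtain a b where "a \<in> N" "b \<in> M" "fo_pair M E m a b"
      using N(3) by (auto simp: s0_def)
    then show ?thesis using mPL fo_pair_pr pr_inject mP(1) mL(1) m NM by auto
  qed
  have "mL \<in> N"
  proof -
    have sN: "s0 i \<in> N" for i
      using N(3) by (simp add: s0_def)
    have "sat M E s0 (FEx 2 (FEx 1 (fm_pair 0 1 2)))"
      using mPL mP(1) mL(1) by (auto simp: s0_def)
    from witness[OF sN this] obtain a b where "b \<in> N" "a \<in> M" "fo_pair M E m a b"
      using N(3) by (auto simp: s0_def)
    then show ?thesis using mPL fo_pair_pr pr_inject mP(1) mL(1) m NM by auto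
  qed
  obtain F where F: "F \<in> N" "fo_guide M E m mP mL F"
  proof -
    have sN: "(s0(1 := mP, 2 := mL)) i \<in> N" for i
      using N(3) \<open>mP \<in> N\<close> \<open>mL \<in> N\<close> by (simp add: s0_def)
    have "sat M E (s0(1 := mP, 2 := mL)) (FEx 3 (fm_guide 0 1 2 3))"
      using guide by (auto simp: s0_def)
    from witness[OF sN this] show ?thesis
      using that N(3) \<open>mP \<in> N\<close> \<open>mL \<in> N\<close> by (auto simp: s0_def)
  qed
  have fn: "fo_functional M E F" using F(2) unfolding fo_guide_def by blast
  define n where "n = mk N"
  have n: "n \<in> M" "mems M E n = N" "\<And>x. x \<in> M \<Longrightarrow> E x n \<longleftrightarrow> x \<in> N"
    using mk[OF NM countable_small[OF N(1)]] mk_mem[OF NM countable_small[OF N(1)]]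
    unfolding n_def by auto
  have F_closed: "y \<in> N" if xyz: "x \<in> N" "y \<in> M" "z \<in> M" "E z F" "fo_pair M E z x y" for x y z
  proof -
    have sN: "(s0(1 := x, 2 := F)) i \<in> N" for i
      using N(3) xyz(1) F(1) by (simp add: s0_def)
    have "sat M E (s0(1 := x, 2 := F)) (FEx 3 (FEx 4 (FConj (FMem 4 2) (fm_pair 4 1 3))))"
      using xyz by auto
    from witness[OF sN this] obtain y' z' where
      "y' \<in> N" "z' \<in> M" "E z' F" "fo_pair M E z' x y'"
      using N(3) xyz(1) F(1) by (auto simp: s0_def)
    \<comment> \<open>Functionality of \<open>F\<close> identifies the witness found in
      \<open>N\<close> with the given value.\<close>
    then show ?thesis using fn xyz NM unfolding fo_functional_def by (metis subsetD)
  qed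
  have "fo_closed M E F n"
    unfolding fo_closed_def
  proof (intro conjI ballI impI)
    fix x y z assume "x \<in> M" "y \<in> M" "z \<in> M"
    then show "E x n \<and> E y n \<and> fo_pair M E z x y \<Longrightarrow> E z n"
      and "E x n \<and> E z F \<and> fo_pair M E z x y \<Longrightarrow> E y n"
      using n(3) fo_pair_pr pair_closed F_closed by auto
  qed
  moreover have "fo_countable M E m n" using fo_countable_iff[OF m n(1)] n(2) N(1) by simp
  ultimately obtain z where z: "z \<in> M" "E (c p) z" "fo_generic M E mP mL n z"
    using F(2) n m mP(1) \<open>mP \<in> N\<close> N(3) p c_in[OF p(1)] E_mP unfolding fo_guide_def by blast
  define Z where "Z = {x \<in> P. E (c x) z}"
  have ZP: "Z \<subseteq> P" and pZ: "p \<in> Z" using p z(2) unfolding Z_def by auto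
  have ZN: "c x \<in> N" if "x \<in> Z" for x
    using that z(3) n(3) c_in unfolding Z_def fo_generic_def by blast
  have chain: "le x y \<or> le y x" if "x \<in> Z" "y \<in> Z" for x y
    using that z(3) c_in fo_le_iff unfolding Z_def fo_generic_def by blast
  have meets: "D \<inter> Z \<noteq> {}" if D: "dense D" "code D \<in> N" for D
  proof -
    have DP: "D \<subseteq> P" using D unfolding dense_def by blast
    have "fo_dense M E mP mL (code D)" using D fo_dense_iff[OF DP] unfolding dense_def by blast
    then obtain x where x: "x \<in> M" "E x (code D)" "E x z"
      using z(3) D(2) n(3) NM unfolding fo_generic_def by blast
    then show ?thesis using code(3)[OF DP] DP unfolding Z_def by blast
  qed
  obtain q where q: "q \<in> P" "\<And>x. x \<in> Z \<Longrightarrow> le q x"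
  proof -
    obtain a where a: "a \<in> M" "E a mP" "\<And>x. x \<in> M \<Longrightarrow> E x z \<Longrightarrow> fo_le M E mL a x"
      using z(3) unfolding fo_generic_def by blast
    then obtain q where q: "q \<in> P" "a = c q" using E_mP by blast
    have "le q x" if "x \<in> Z" for x
      using a(3)[OF c_in[of x]] fo_le_iff[OF q(1)] q(2) that unfolding Z_def by blast
    then show thesis using that q(1) by blast
  qed
  have "countable Z"
  proof -
    have "c ` Z \<subseteq> N" using ZN by blast
    then have "countable (c ` Z)" using N(1) countable_subset by blast
    then show ?thesis by (rule countable_image_inj_on[OF _ inj_on_subset[OF inj_c ZP]])
  qed
  define e where "e = from_nat_into Z"
  have e: "e k \<in> Z" for k unfolding e_def by (rule from_nat_into) (use pZ in blast)
  \<comment> \<open>Move to \<open>e k\<close> if it is below, otherwise stay. As \<open>Z\<close>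
    is a chain, \<open>s (Suc k)\<close> is below \<open>e k\<close> either way, so an open set
    containing \<open>e k\<close> contains \<open>s (Suc k)\<close>. Reflexivity on \<open>Z\<close>
    is \<open>chain\<close> with equal arguments.\<close>
  define s where "s = rec_nat p (\<lambda>k x. if le (e k) x then e k else x)"
  have s0: "s 0 = p" and sS: "s (Suc k) = (if le (e k) (s k) then e k else s k)" for k
    unfolding s_def by auto
  have sZ: "s k \<in> Z" for k by (induction k) (auto simp: s0 sS pZ e)
  have "le (s (Suc k)) (s k)" for k using chain[OF sZ sZ] sS by auto
  moreover have "\<exists>k. s k \<in> D" if D: "dense_open P le D" "d \<in> N" "mems M E d = c ` D" for D d
  proof -
    have DP: "D \<subseteq> P" using D unfolding dense_open_def by blast
    have "code D = d" using mems_ext[OF code(1)[OF DP]] D NM code(2)[OF DP] by auto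
    then obtain x where x: "x \<in> D" "x \<in> Z"
      using meets[of D] D unfolding dense_def dense_open_def by blast
    obtain k where k: "x = e k"
      unfolding e_def using from_nat_into_surj[OF \<open>countable Z\<close> x(2)] by metis
    have "le (s (Suc k)) (e k)" using chain[OF sZ[of k] e[of k]] chain[OF e e, of k k] sS[of k] by auto
    then have "s (Suc k) \<in> D"
      using D(1) x k sZ ZP unfolding dense_open_def by blast
    then show ?thesis by blast
  qed
  ultimately have "s 0 = p \<and> (\<forall>n. s n \<in> P \<and> c (s n) \<in> N \<and> le (s (Suc n)) (s n)) \<and>
    (\<forall>D. dense_open P le D \<and> (\<exists>d\<in>N. mems M E d = c ` D) \<longrightarrow> (\<exists>n. s n \<in> D)) \<and>
    (\<exists>q\<in>P. \<forall>n. le q (s n))"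
    using s0 sZ ZP ZN q by blast
  then show ?thesis by blast
qed

end

text \<open>This removes H(\<lambda>) from the problem: it remains to choose a countable-valued
  operation \<open>A\<close> and to build chains in countable sets of conditions closed under
  it.\<close>

lemma totally_properI:
  fixes P :: "'p set" and le :: "'p \<Rightarrow> 'p \<Rightarrow> bool" and A :: "'p \<Rightarrow> 'p \<Rightarrow> 'p set \<Rightarrow> 'p set"
  assumes refl: "\<And>p. p \<in> P \<Longrightarrow> le p p"
    and A: "\<And>p r D. p \<in> P \<Longrightarrow> r \<in> P \<Longrightarrow> D \<subseteq> P \<Longrightarrow> countable (A p r D) \<and> A p r D \<subseteq> P"
    and gen: "\<And>Q \<D> p. countable Q \<Longrightarrow> countable \<D> \<Longrightarrow> Q \<subseteq> P \<Longrightarrow> P \<in> \<D> \<Longrightarrow>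
      (\<And>D. D \<in> \<D> \<Longrightarrow> D \<subseteq> P \<and> (\<forall>x\<in>P. \<exists>y\<in>D. le y x)) \<Longrightarrow>
      (\<And>p r D. p \<in> Q \<Longrightarrow> r \<in> Q \<Longrightarrow> D \<in> \<D> \<Longrightarrow> A p r D \<subseteq> Q) \<Longrightarrow> p \<in> Q \<Longrightarrow>
      \<exists>Z\<subseteq>Q. p \<in> Z \<and> (\<forall>x\<in>Z. \<forall>y\<in>Z. le x y \<or> le y x) \<and> (\<forall>D\<in>\<D>. D \<inter> Z \<noteq> {}) \<and>
        (\<exists>q\<in>P. \<forall>x\<in>Z. le q x)"
  shows "totally_proper TYPE('m) P le"
  unfolding totally_proper_def
proof (intro allI impI ballI, elim conjE)
  fix lam :: "'m rel" and M :: "'m set" and E and c :: "'p \<Rightarrow> 'm" and N :: "'m set" and m and p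
  assume *: "Card_order lam" "regularCard lam" "natLeq <o lam" "|Pow P| <o lam"
    "H_structure lam M E" "inj_on c P" "codes_forcing M E c P le m"
    "countable N" "elementary_submodel N M E" "m \<in> N" "p \<in> P" "c p \<in> N"
  obtain mP mL where mPL: "mP \<in> M" "mL \<in> M" "is_pair M E m mP mL" "mems M E mP = c ` P"
    "mems M E mL = {z \<in> M. \<exists>p\<in>P. \<exists>q\<in>P. le p q \<and> is_pair M E z (c p) (c q)}"
    using *(7) unfolding codes_forcing_def by blast
  have "m \<in> M" using *(9,10) unfolding elementary_submodel_def by blast
  interpret H_forcing lam M E c P le m mP mL
    by unfold_locales (use * mPL \<open>m \<in> M\<close> in auto)
  show "\<exists>s. s 0 = p \<and> (\<forall>n. s n \<in> P \<and> c (s n) \<in> N \<and> le (s (Suc n)) (s n)) \<and>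
    (\<forall>D. dense_open P le D \<and> (\<exists>d\<in>N. mems M E d = c ` D) \<longrightarrow> (\<exists>n. s n \<in> D)) \<and>
    (\<exists>q\<in>P. \<forall>n. le q (s n))"
  proof (rule generic_sequence[OF *(8-10) mPL(3) _ *(11,12)], rule ex_guide[OF refl A])
    fix Q \<D> p
    assume "countable Q" "countable \<D>" "Q \<subseteq> P" "P \<in> \<D>" "\<And>D. D \<in> \<D> \<Longrightarrow> dense D"
      "\<And>p r D. p \<in> Q \<Longrightarrow> r \<in> Q \<Longrightarrow> D \<in> \<D> \<Longrightarrow> A p r D \<subseteq> Q" "p \<in> Q"
    then show "\<exists>Z\<subseteq>Q. p \<in> Z \<and> (\<forall>x\<in>Z. \<forall>y\<in>Z. le x y \<or> le y x) \<and> (\<forall>D\<in>\<D>. D \<inter> Z \<noteq> {}) \<and>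
        (\<exists>q\<in>P. \<forall>x\<in>Z. le q x)"
      using gen[of Q \<D> p] unfolding dense_def by blast
  qed auto
qed

section \<open>Preliminaries on \<open>\<omega>\<^sub>1\<close> and closed filters\<close>

text \<open>Otherwise countably many countable initial segments would cover
  \<open>omega1\<close>.\<close>

lemma omega1_bounded:
  fixes S :: "omega1 set"
  assumes "countable S"
  shows "\<exists>b. \<forall>a\<in>S. a < b"
proof (rule ccontr)
  assume "\<not> ?thesis"
  then have "\<forall>b. \<exists>a\<in>S. b \<le> a" by (meson not_less)
  then have "UNIV = (\<Union>a\<in>S. insert a {..<a})" by (auto simp: order_le_less)
  moreover have "countable (\<Union>a\<in>S. insert a {..<a})"
    using assms countable_lessThan_omega1 by auto
  ultimately show False using uncountable_omega1 by simp
qed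

lemma card_omega1: "|UNIV :: omega1 set| =o cardSuc natLeq"
proof -
  have "bij_betw Rep_omega1 UNIV (Field (cardSuc natLeq))"
    by (metis bij_betw_imageI Rep_omega1_inject injI type_definition.Rep_range type_definition_omega1)
  then have "|UNIV :: omega1 set| =o |Field (cardSuc natLeq)|"
    using card_of_ordIso by blast
  then show ?thesis
    using card_of_Field_ordIso[OF cardSuc_Card_order[OF natLeq_Card_order]] ordIso_transitive by blast
qed

lemma CH_enumerate_countable_subsets:
  assumes CH and W: "|W| \<le>o cardSuc natLeq"
  shows "\<exists>g :: omega1 \<Rightarrow> 'a set. \<forall>S\<subseteq>W. countable S \<longrightarrow> S \<in> range g"
proof -
  have "|UNIV :: nat set set| =o |UNIV :: real set|"
    using nat_sets_eqpoll_reals eqpoll_iff_card_of_ordIso by blast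
  then have sets: "|UNIV :: nat set set| =o cardSuc natLeq"
    using \<open>CH\<close> ordIso_transitive unfolding CH_def by blast
  then have "|W| \<le>o |UNIV :: nat set set|"
    using W ordIso_symmetric ordLeq_ordIso_trans by blast
  then obtain h :: "'a \<Rightarrow> nat set" where h: "inj_on h W"
    unfolding card_of_ordLeq[symmetric] by blast
  \<comment> \<open>Codes are made nonempty so that the constantly empty sequence can stand for the
    empty subset.\<close>
  define h' where "h' x = insert 0 (Suc ` h x)" for x
  have h': "h' x \<noteq> {}" "x \<in> W \<Longrightarrow> y \<in> W \<Longrightarrow> h' x = h' y \<Longrightarrow> x = y" for x y
  proof -
    show "h' x \<noteq> {}" by (simp add: h'_def)
    assume "x \<in> W" "y \<in> W" "h' x = h' y"
    then have "Suc ` h x = Suc ` h y" unfolding h'_def by (auto simp: set_eq_iff image_iff)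
    then have "h x = h y" by (simp add: inj_image_eq_iff)
    then show "x = y" using h \<open>x \<in> W\<close> \<open>y \<in> W\<close> by (auto dest: inj_onD)
  qed
  have "inj (\<lambda>f :: nat \<Rightarrow> nat set. {prod_encode (k, j) |k j. j \<in> f k})"
  proof (rule injI, rule ext, rule set_eqI)
    fix f g :: "nat \<Rightarrow> nat set" and k j
    assume "{prod_encode (k, j) |k j. j \<in> f k} = {prod_encode (k, j) |k j. j \<in> g k}"
    then have "prod_encode (k, j) \<in> {prod_encode (k, j) |k j. j \<in> f k} \<longleftrightarrow>
      prod_encode (k, j) \<in> {prod_encode (k, j) |k j. j \<in> g k}" by simp
    then show "j \<in> f k \<longleftrightarrow> j \<in> g k" by auto
  qed
  then have "|UNIV :: (nat \<Rightarrow> nat set) set| \<le>o |UNIV :: nat set set|"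
    by (rule card_of_ordLeqI) simp
  moreover have "|UNIV :: nat set set| =o |UNIV :: omega1 set|"
    using sets card_omega1 ordIso_symmetric ordIso_transitive by blast
  ultimately have "|UNIV :: (nat \<Rightarrow> nat set) set| \<le>o |UNIV :: omega1 set|"
    using ordLeq_ordIso_trans by blast
  then obtain i :: "(nat \<Rightarrow> nat set) \<Rightarrow> omega1" where i: "inj i"
    unfolding card_of_ordLeq[symmetric] by blast
  \<comment> \<open>The index \<open>a\<close> is read as the sequence \<open>inv i a\<close>, and
    \<open>g a\<close> collects the points whose codes occur in it.\<close>
  define g where "g a = {x \<in> W. \<exists>k. inv i a k = h' x}" for a
  have "S \<in> range g" if S: "S \<subseteq> W" "countable S" for S
  proof -
    define f where "f k = (if S = {} then {} else h' (from_nat_into S k))" for k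
    have "x \<in> S \<longleftrightarrow> x \<in> W \<and> (\<exists>k. f k = h' x)" for x
    proof (cases "S = {}")
      case True
      then show ?thesis using h'(1)[of x] by (auto simp: f_def)
    next
      case False
      then have "range (from_nat_into S) = S" using S(2) by simp
      then have S': "from_nat_into S k \<in> S" "x \<in> S \<Longrightarrow> \<exists>k. from_nat_into S k = x" for k
        by (metis rangeI, metis rangeE)
      have fk: "f k = h' (from_nat_into S k)" for k using False by (simp add: f_def)
      show ?thesis
      proof
        assume "x \<in> S"
        then show "x \<in> W \<and> (\<exists>k. f k = h' x)" using S'(2) S(1) fk by blast
      next
        assume "x \<in> W \<and> (\<exists>k. f k = h' x)"
        then obtain k where "x \<in> W" "h' (from_nat_into S k) = h' x" using fk by auto
        then show "x \<in> S" using h'(2) S'(1)[of k] S(1) by blast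
      qed
    qed
    then have "S = g (i f)" unfolding g_def using i by (auto simp: inv_f_f)
    then show ?thesis by blast
  qed
  then show ?thesis by blast
qed

section \<open>Maximal and product filters of closed sets\<close>

text \<open>If \<open>A\<close> met every member, the closed sets containing some
  \<open>A \<inter> B\<close> with \<open>B\<close> in \<open>F\<close> would form a larger
  filter.\<close>

lemma maximal_closed_filter_disjoint:
  assumes F: "maximal_closed_filter Z F" and A: "closedin Z A" "A \<notin> F"
  shows "\<exists>B\<in>F. A \<inter> B = {}"
proof (rule ccontr)
  assume none: "\<not> ?thesis"
  have cf: "closed_filter Z F" using F unfolding maximal_closed_filter_def by blast
  define G where "G = {C. closedin Z C \<and> (\<exists>B\<in>F. A \<inter> B \<subseteq> C)}"
  have "closed_filter Z G"
    unfolding closed_filter_def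
  proof (intro conjI ballI allI impI)
    show "G \<subseteq> {C. closedin Z C}" unfolding G_def by blast
    show "topspace Z \<in> G"
      using cf A closedin_subset unfolding G_def closed_filter_def by blast
    show "{} \<notin> G" using none unfolding G_def by blast
  next
    fix C D assume "C \<in> G" "D \<in> G"
    then obtain B B' where "closedin Z C" "closedin Z D" "B \<in> F" "B' \<in> F" "A \<inter> B \<subseteq> C" "A \<inter> B' \<subseteq> D"
      unfolding G_def by blast
    moreover from this have "B \<inter> B' \<in> F" using cf unfolding closed_filter_def by blast
    ultimately show "C \<inter> D \<in> G" unfolding G_def by blast
  next
    fix C D assume "C \<in> G" "closedin Z D \<and> C \<subseteq> D"
    then show "D \<in> G" unfolding G_def by blast
  qed
  moreover have "F \<subseteq> G" using cf unfolding G_def closed_filter_def by blast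
  moreover have "A \<in> G" using A cf unfolding G_def closed_filter_def by blast
  ultimately show False using F A(2) unfolding maximal_closed_filter_def by blast
qed

text \<open>Members of \<open>F\<close> disjoint from \<open>A\<close> and from \<open>C\<close>
  would intersect in a member disjoint from the union. So two closed sets outside \<open>F\<close>
  have a union outside \<open>F\<close>.\<close>

lemma maximal_closed_filter_Un:
  assumes F: "maximal_closed_filter Z F" and A: "closedin Z A" "closedin Z C" "A \<union> C \<in> F"
  shows "A \<in> F \<or> C \<in> F"
proof (rule ccontr)
  assume not: "\<not> ?thesis"
  have cf: "closed_filter Z F" using F unfolding maximal_closed_filter_def by blast
  obtain B where B: "B \<in> F" "A \<inter> B = {}"
    using maximal_closed_filter_disjoint[OF F A(1)] not by blast
  obtain B' where B': "B' \<in> F" "C \<inter> B' = {}"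
    using maximal_closed_filter_disjoint[OF F A(2)] not by blast
  have "B \<inter> B' \<in> F" using cf B(1) B'(1) unfolding closed_filter_def by blast
  then have "(A \<union> C) \<inter> (B \<inter> B') \<in> F" using cf A(3) unfolding closed_filter_def by blast
  moreover have "(A \<union> C) \<inter> (B \<inter> B') = {}" using B(2) B'(2) by blast
  ultimately show False using cf unfolding closed_filter_def by simp
qed

text \<open>The closed sets containing a box already form a closed filter that contains the
  generators.\<close>

lemma product_filter_box:
  assumes F: "\<And>\<xi>. \<xi> \<in> v \<Longrightarrow> closed_filter (X \<xi>) (\<U> (X \<xi>))"
    and C: "C \<in> product_filter \<U> X v"
  shows "\<exists>A. (\<forall>\<xi>\<in>v. A \<xi> \<in> \<U> (X \<xi>)) \<and> Pi\<^sub>E v A \<subseteq> C"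
proof -
  let ?Z = "product_topology X v"
  define G where "G = {C. closedin ?Z C \<and> (\<exists>A. (\<forall>\<xi>\<in>v. A \<xi> \<in> \<U> (X \<xi>)) \<and> Pi\<^sub>E v A \<subseteq> C)}"
  have box: "closedin ?Z (Pi\<^sub>E v A)" "Pi\<^sub>E v A \<noteq> {}" if "\<forall>\<xi>\<in>v. A \<xi> \<in> \<U> (X \<xi>)" for A
  proof -
    show "closedin ?Z (Pi\<^sub>E v A)"
      unfolding closedin_product_topology using F that unfolding closed_filter_def by blast
    show "Pi\<^sub>E v A \<noteq> {}"
      using F that unfolding closed_filter_def PiE_eq_empty_iff by metis
  qed
  have "closed_filter ?Z G"
    unfolding closed_filter_def
  proof (intro conjI ballI allI impI)
    show "G \<subseteq> {C. closedin ?Z C}" unfolding G_def by blast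
    have "\<forall>\<xi>\<in>v. topspace (X \<xi>) \<in> \<U> (X \<xi>)" using F unfolding closed_filter_def by blast
    then show "topspace ?Z \<in> G"
      unfolding G_def mem_Collect_eq
      by (intro conjI closedin_topspace exI[of _ "\<lambda>\<xi>. topspace (X \<xi>)"]) simp_all
    show "{} \<notin> G" using box(2) unfolding G_def by blast
  next
    fix C D assume "C \<in> G" "D \<in> G"
    then obtain A A' where *: "closedin ?Z C" "closedin ?Z D" "\<forall>\<xi>\<in>v. A \<xi> \<in> \<U> (X \<xi>)"
      "\<forall>\<xi>\<in>v. A' \<xi> \<in> \<U> (X \<xi>)" "Pi\<^sub>E v A \<subseteq> C" "Pi\<^sub>E v A' \<subseteq> D"
      unfolding G_def by blast
    have "\<forall>\<xi>\<in>v. A \<xi> \<inter> A' \<xi> \<in> \<U> (X \<xi>)" using F *(3,4) unfolding closed_filter_def by blast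
    moreover have "Pi\<^sub>E v (\<lambda>\<xi>. A \<xi> \<inter> A' \<xi>) \<subseteq> C \<inter> D" using *(5,6) by (auto simp flip: PiE_Int)
    ultimately show "C \<inter> D \<in> G"
      unfolding G_def mem_Collect_eq
      by (intro conjI closedin_Int[OF *(1,2)] exI[of _ "\<lambda>\<xi>. A \<xi> \<inter> A' \<xi>"])
  next
    fix C D assume "C \<in> G" "closedin ?Z D \<and> C \<subseteq> D"
    then show "D \<in> G" unfolding G_def by blast
  qed
  moreover have "{Pi\<^sub>E v A |A. \<forall>\<xi>\<in>v. A \<xi> \<in> \<U> (X \<xi>)} \<subseteq> G" using box(1) unfolding G_def by blast
  ultimately have "product_filter \<U> X v \<subseteq> G"
    unfolding product_filter_def generated_closed_filter_def by blast
  then show ?thesis using C unfolding G_def by blast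
qed

section \<open>Extensions near the diagonal\<close>

locale safe_collection =
  fixes \<U> :: "'a topology \<Rightarrow> 'a set set"
    and Y :: "'a topology \<Rightarrow> 'a set"
    and e :: "'a topology \<Rightarrow> omega1 \<Rightarrow> 'a"
    and \<B> :: "'a topology \<Rightarrow> omega1 \<Rightarrow> nat \<Rightarrow> 'a set"
    and K :: "'k set"
    and X :: "'k \<Rightarrow> 'a topology"
  assumes CH: CH
    and fixed_data: "fixed_data \<U> Y e \<B>"
    and relevant: "\<xi> \<in> K \<Longrightarrow> relevant (X \<xi>)"
    and safe: "safe \<U> \<B> K X"
begin

abbreviation P :: "('k, 'a) cond set" where "P \<equiv> conds \<U> K X"

abbreviation le :: "('k, 'a) cond \<Rightarrow> ('k, 'a) cond \<Rightarrow> bool" where "le \<equiv> cond_le \<B> X"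

abbreviation sec :: "('k, 'a) cond \<Rightarrow> 'k \<Rightarrow> 'a set" where "sec \<equiv> cond_section"

lemma data:
  assumes "\<xi> \<in> K"
  shows "maximal_closed_filter (X \<xi>) (\<U> (X \<xi>))" "closed_filter (X \<xi>) (\<U> (X \<xi>))"
    "\<Inter>(\<U> (X \<xi>)) = {}" "diagonalizes (Y (X \<xi>)) (\<U> (X \<xi>))"
    "right_separated_by (X \<xi>) (Y (X \<xi>)) (e (X \<xi>))"
    "decreasing_nbhd_base (X \<xi>) (e (X \<xi>) \<alpha>) (\<B> (X \<xi>) \<alpha>)"
  using fixed_data relevant[OF assms] unfolding fixed_data_def maximal_closed_filter_def by blast+

section \<open>Diagonal points and their neighborhoods\<close>

lemma nbhd:
  assumes "\<xi> \<in> K"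
  shows "openin (X \<xi>) (\<B> (X \<xi>) \<alpha> k)" "e (X \<xi>) \<alpha> \<in> \<B> (X \<xi>) \<alpha> k"
    "openin (X \<xi>) W \<Longrightarrow> e (X \<xi>) \<alpha> \<in> W \<Longrightarrow> \<exists>k. \<B> (X \<xi>) \<alpha> k \<subseteq> W"
  using data(6)[OF assms, of \<alpha>] unfolding decreasing_nbhd_base_def by simp_all

lemma diagonal_in:
  assumes "\<xi> \<in> K"
  shows "e (X \<xi>) \<alpha> \<in> topspace (X \<xi>)"
  using openin_subset[OF nbhd(1)[OF assms]] nbhd(2)[OF assms] by blast

lemma nbhd_antimono:
  assumes "\<xi> \<in> K" "k \<le> k'"
  shows "\<B> (X \<xi>) \<alpha> k' \<subseteq> \<B> (X \<xi>) \<alpha> k"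
proof (rule lift_Suc_antimono_le[OF _ assms(2)])
  show "\<B> (X \<xi>) \<alpha> (Suc n) \<subseteq> \<B> (X \<xi>) \<alpha> n" for n
    using data(6)[OF assms(1), of \<alpha>] unfolding decreasing_nbhd_base_def by simp
qed

lemma closure_of_empty_notin: "\<xi> \<in> K \<Longrightarrow> X \<xi> closure_of {} \<notin> \<U> (X \<xi>)"
  using data(2) unfolding closed_filter_def by (metis closure_of_empty)

lemma closed_filter_up:
  "\<xi> \<in> K \<Longrightarrow> A \<in> \<U> (X \<xi>) \<Longrightarrow> closedin (X \<xi>) C \<Longrightarrow> A \<subseteq> C \<Longrightarrow> C \<in> \<U> (X \<xi>)"
  using data(2)[of \<xi>] unfolding closed_filter_def by blast

text \<open>Since the filter has empty intersection, some member misses the point; regularity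
  separates the two, so a basic neighborhood has closure disjoint from that member.\<close>

lemma small_nbhd:
  assumes \<xi>: "\<xi> \<in> K"
  shows "\<exists>k. X \<xi> closure_of \<B> (X \<xi>) \<alpha> k \<notin> \<U> (X \<xi>)"
proof -
  let ?Z = "X \<xi>" and ?x = "e (X \<xi>) \<alpha>"
  obtain A where A: "A \<in> \<U> ?Z" "?x \<notin> A" using data(3)[OF \<xi>] by blast
  have cA: "closedin ?Z A" using A data(2)[OF \<xi>] unfolding closed_filter_def by blast
  have "?x \<in> topspace ?Z" by (rule diagonal_in[OF \<xi>])
  then obtain V W where VW: "openin ?Z V" "openin ?Z W" "?x \<in> V" "A \<subseteq> W" "disjnt V W"
    using relevant[OF \<xi>] cA A(2) unfolding relevant_def regular_space_def by blast
  obtain k where k: "\<B> ?Z \<alpha> k \<subseteq> V"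
    using nbhd(3)[OF \<xi> VW(1,3)] by blast
  have "\<B> ?Z \<alpha> k \<subseteq> topspace ?Z - W"
    using k VW(5) openin_subset[OF VW(1)] unfolding disjnt_def by blast
  then have "?Z closure_of \<B> ?Z \<alpha> k \<subseteq> topspace ?Z - W"
    using VW(2) by (intro closure_of_minimal) auto
  then have "A \<inter> ?Z closure_of \<B> ?Z \<alpha> k = {}" using VW(4) by blast
  then show ?thesis
    using A(1) data(2)[OF \<xi>] unfolding closed_filter_def by metis
qed

section \<open>Conditions and their order\<close>

lemma sec_mono:
  assumes "le q p"
  shows "sec p \<xi> \<subseteq> sec q \<xi>"
proof
  fix x assume x: "x \<in> sec p \<xi>"
  have "fst p \<subseteq>\<^sub>m fst q" using assms unfolding cond_le_def by blast
  then have "fst p (\<xi>, x) = fst q (\<xi>, x)" using x unfolding cond_section_def map_le_def by blast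
  then show "x \<in> sec q \<xi>" using x unfolding cond_section_def by simp
qed

lemma kept_refl [simp]: "kept_set \<B> X v f p p = dom f"
  unfolding kept_set_def by auto

lemma condD:
  assumes "p \<in> P"
  shows "countable (dom (fst p))" "dom (fst p) \<subseteq> Sigma K (\<lambda>\<xi>. topspace (X \<xi>))"
    "\<xi> \<in> K \<Longrightarrow> X \<xi> closure_of sec p \<xi> \<notin> \<U> (X \<xi>)" "countable (snd p)"
    "(v, f) \<in> snd p \<Longrightarrow> finite v \<and> v \<subseteq> K \<and> uncountable (dom f)"
proof -
  obtain a \<Phi> where p: "p = (a, \<Phi>)" by (cases p)
  note * = assms[unfolded p conds_def mem_Collect_eq prod.case]
  show "countable (dom (fst p))" "dom (fst p) \<subseteq> Sigma K (\<lambda>\<xi>. topspace (X \<xi>))"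
    "\<xi> \<in> K \<Longrightarrow> X \<xi> closure_of sec p \<xi> \<notin> \<U> (X \<xi>)" "countable (snd p)"
    unfolding p using * by simp_all
  assume "(v, f) \<in> snd p"
  then have "(v, f) \<in> \<Phi>" unfolding p by simp
  with * have "case (v, f) of (v, f) \<Rightarrow> finite v \<and> v \<subseteq> K \<and> is_promise f" by (elim conjE bspec)
  then show "finite v \<and> v \<subseteq> K \<and> uncountable (dom f)" unfolding is_promise_def by simp
qed

lemma condI:
  assumes "countable (dom (fst p))" "dom (fst p) \<subseteq> Sigma K (\<lambda>\<xi>. topspace (X \<xi>))"
    "\<And>\<xi>. \<xi> \<in> K \<Longrightarrow> X \<xi> closure_of sec p \<xi> \<notin> \<U> (X \<xi>)" "countable (snd p)"
    "\<And>v f. (v, f) \<in> snd p \<Longrightarrow> finite v \<and> v \<subseteq> K \<and> uncountable (dom f)"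
  shows "p \<in> P"
proof -
  have "case t of (v, f) \<Rightarrow> finite v \<and> v \<subseteq> K \<and> is_promise f" if "t \<in> snd p" for t
    using assms(5)[of "fst t" "snd t"] that by (simp add: case_prod_beta is_promise_def)
  then show ?thesis using assms(1-4) unfolding conds_def by (cases p) simp
qed

lemma leI:
  assumes "fst p \<subseteq>\<^sub>m fst q" "snd p \<subseteq> snd q"
    "\<And>v f. (v, f) \<in> snd p \<Longrightarrow> uncountable (kept_set \<B> X v f q p)"
    "\<And>v f. (v, f) \<in> snd p \<Longrightarrow> (v, f |` kept_set \<B> X v f q p) \<in> snd q"
  shows "le q p"
  using assms unfolding cond_le_def by auto

lemma leD:
  assumes "le q p"
  shows "fst p \<subseteq>\<^sub>m fst q" "snd p \<subseteq> snd q"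
    "(v, f) \<in> snd p \<Longrightarrow> uncountable (kept_set \<B> X v f q p)"
    "(v, f) \<in> snd p \<Longrightarrow> (v, f |` kept_set \<B> X v f q p) \<in> snd q"
  using assms unfolding cond_le_def by auto

lemma le_refl:
  assumes "p \<in> P"
  shows "le p p"
proof (rule leI)
  fix v f assume "(v, f) \<in> snd p"
  moreover have "f |` dom f = f" by (auto simp: restrict_map_def domIff)
  ultimately show "uncountable (kept_set \<B> X v f p p)" "(v, f |` kept_set \<B> X v f p p) \<in> snd p"
    using condD(5)[OF assms] by auto
qed auto

text \<open>The points added from \<open>p\<close> to \<open>r\<close> are those added from
  \<open>p\<close> to \<open>q\<close> and those added from \<open>q\<close> to \<open>r\<close>;
  restricting \<open>f\<close> accounts for the former.\<close>

lemma kept_trans: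
  assumes "le q p" "le r q"
  shows "kept_set \<B> X v (f |` kept_set \<B> X v f q p) r q = kept_set \<B> X v f r p"
proof -
  have "sec p \<xi> \<subseteq> sec q \<xi>" "sec q \<xi> \<subseteq> sec r \<xi>" for \<xi> using assms sec_mono by blast+
  then have "sec r \<xi> - sec p \<xi> = (sec q \<xi> - sec p \<xi>) \<union> (sec r \<xi> - sec q \<xi>)" for \<xi> by blast
  then have 1: "\<beta> \<in> kept_set \<B> X v f r p \<longleftrightarrow> \<beta> \<in> kept_set \<B> X v f q p \<and>
    (\<forall>\<xi>\<in>v. sec r \<xi> - sec q \<xi> \<subseteq> \<B> (X \<xi>) \<beta> (the (f \<beta>)))" for \<beta>
    unfolding kept_set_def by auto
  have 2: "\<beta> \<in> kept_set \<B> X v (f |` S) r q \<longleftrightarrow> \<beta> \<in> dom f \<and> \<beta> \<in> S \<and>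
    (\<forall>\<xi>\<in>v. sec r \<xi> - sec q \<xi> \<subseteq> \<B> (X \<xi>) \<beta> (the (f \<beta>)))" for \<beta> S
    unfolding kept_set_def by (cases "\<beta> \<in> S") auto
  have 3: "kept_set \<B> X v f q p \<subseteq> dom f" unfolding kept_set_def by blast
  show ?thesis by (rule set_eqI, unfold 1 2) (use 3 in blast)
qed

text \<open>The order is transitive because \<open>q\<close> carries the restricted promise:
  \<open>r\<close> restricts it further, and both restrictions together are the restriction from
  \<open>p\<close> to \<open>r\<close>.\<close>

lemma le_trans:
  assumes "le r q" "le q p"
  shows "le r p"
proof (rule leI)
  show "fst p \<subseteq>\<^sub>m fst r" using assms leD(1) map_le_trans by blast
  show "snd p \<subseteq> snd r" using assms leD(2) by blast
  fix v f assume vf: "(v, f) \<in> snd p"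
  let ?f = "f |` kept_set \<B> X v f q p"
  have "(v, ?f) \<in> snd q" using leD(4)[OF assms(2) vf] .
  note this = leD(3,4)[OF assms(1) this]
  moreover have "?f |` kept_set \<B> X v f r p = f |` kept_set \<B> X v f r p"
  proof -
    have "kept_set \<B> X v f r p \<subseteq> kept_set \<B> X v f q p"
      using sec_mono[OF assms(1)] unfolding kept_set_def by blast
    then show ?thesis by (simp add: Int_absorb1)
  qed
  ultimately show "uncountable (kept_set \<B> X v f r p)" "(v, f |` kept_set \<B> X v f r p) \<in> snd r"
    unfolding kept_trans[OF assms(2,1)] by simp_all
qed

lemma add_promise:
  assumes "p \<in> P" "finite v" "v \<subseteq> K" "uncountable (dom f)"
  shows "(fst p, insert (v, f) (snd p)) \<in> P"
proof (rule condI)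
  fix w h assume "(w, h) \<in> snd (fst p, insert (v, f) (snd p))"
  then have "w = v \<and> h = f \<or> (w, h) \<in> snd p" by simp
  then show "finite w \<and> w \<subseteq> K \<and> uncountable (dom h)"
    using condD(5)[OF assms(1), of w h] assms(2-4) by (elim disjE conjE) simp_all
qed (use condD[OF assms(1)] in \<open>simp_all add: cond_section_def\<close>)

lemma countable_sec:
  assumes "p \<in> P"
  shows "countable (Sigma v (sec p))" "\<xi> \<in> K \<Longrightarrow> sec p \<xi> \<subseteq> topspace (X \<xi>)"
proof -
  have "Sigma v (sec p) \<subseteq> dom (fst p)" by (auto simp: cond_section_def)
  then show "countable (Sigma v (sec p))" using condD(1)[OF assms] countable_subset by blast
  show "\<xi> \<in> K \<Longrightarrow> sec p \<xi> \<subseteq> topspace (X \<xi>)"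
    using condD(2)[OF assms] by (auto simp: cond_section_def)
qed

section \<open>Traces of extensions and promises near diagonal points\<close>

lemma card_points:
  assumes "finite v" "v \<subseteq> K"
  shows "|Sigma v (\<lambda>\<xi>. topspace (X \<xi>))| \<le>o cardSuc natLeq"
proof (rule card_of_Sigma_ordLeq_infinite_Field)
  show "infinite (Field (cardSuc natLeq))"
    using cardSuc_finite[OF natLeq_Card_order] Field_natLeq by auto
  show "Card_order (cardSuc natLeq)" by (rule cardSuc_Card_order[OF natLeq_Card_order])
  have "|v| \<le>o natLeq" using assms(1) countable_finite countable_card_le_natLeq by blast
  then show "|v| \<le>o cardSuc natLeq"
    using cardSuc_ordLeq[OF natLeq_Card_order] ordLeq_transitive by blast
  show "\<forall>\<xi>\<in>v. |topspace (X \<xi>)| \<le>o cardSuc natLeq"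
    using assms(2) relevant unfolding relevant_def by (auto intro: ordIso_imp_ordLeq)
qed

text \<open>By CH the traces on \<open>v\<close> of the extensions of \<open>p\<close> in \<open>D\<close> can be listed in type \<open>\<omega>\<^sub>1\<close>. If for
  uncountably many \<open>\<alpha>\<close> some neighborhood of \<open>\<alpha>\<close> contained no trace listed before \<open>\<alpha>\<close>, then these
  neighborhoods would form a promise, and an extension in \<open>D\<close> of \<open>p\<close> together with this promise
  would have a trace listed before uncountably many of the \<open>\<alpha>\<close> that keep the promise.\<close>

lemma dense_extensions_near_diagonal:
  assumes p: "p \<in> P" and D: "D \<subseteq> P" "\<And>p. p \<in> P \<Longrightarrow> \<exists>q\<in>D. le q p" and v: "finite v" "v \<subseteq> K"
  shows "\<exists>(q :: omega1 \<Rightarrow> ('k, 'a) cond) b. (\<forall>i. q i \<in> D) \<and>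
    (\<forall>\<alpha>\<ge>b. \<forall>k. \<exists>i<\<alpha>. le (q i) p \<and> (\<forall>\<xi>\<in>v. sec (q i) \<xi> - sec p \<xi> \<subseteq> \<B> (X \<xi>) \<alpha> k))"
proof -
  define tr where "tr q = Sigma v (\<lambda>\<xi>. sec q \<xi> - sec p \<xi>)" for q
  define G where "G = {q \<in> D. le q p}"
  obtain g :: "omega1 \<Rightarrow> ('k \<times> 'a) set" where
    g: "\<And>S. S \<subseteq> Sigma v (\<lambda>\<xi>. topspace (X \<xi>)) \<Longrightarrow> countable S \<Longrightarrow> S \<in> range g"
    using CH_enumerate_countable_subsets[OF CH card_points[OF v]] by blast
  \<comment> \<open>Where \<open>g i\<close> is not a trace, any member of \<open>G\<close> serves
    as default.\<close>
  have "\<exists>q\<in>G. g i \<in> tr ` G \<longrightarrow> tr q = g i" for i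
  proof -
    obtain q where "q \<in> G" using D(2)[OF p] unfolding G_def by blast
    then show ?thesis by (metis imageE)
  qed
  then obtain q where qG: "\<And>i. q i \<in> G" and q: "\<And>i. g i \<in> tr ` G \<Longrightarrow> tr (q i) = g i" by metis
  have listed: "\<exists>i. tr (q i) = tr r" if r: "r \<in> G" for r
  proof -
    have rP: "r \<in> P" using r D(1) unfolding G_def by blast
    have "tr r \<subseteq> Sigma v (sec r)" unfolding tr_def by blast
    then have "countable (tr r)" "tr r \<subseteq> Sigma v (\<lambda>\<xi>. topspace (X \<xi>))"
      using countable_sec[OF rP] countable_subset v(2) by blast+
    then obtain i where "tr r = g i" using g by blast
    then show ?thesis using q[of i] r by (metis imageI)
  qed
  define near where "near \<alpha> k i \<longleftrightarrow> tr (q i) \<subseteq> Sigma v (\<lambda>\<xi>. \<B> (X \<xi>) \<alpha> k)" for \<alpha> k i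
  define bad where "bad \<alpha> k \<longleftrightarrow> (\<forall>i<\<alpha>. \<not> near \<alpha> k i)" for \<alpha> k
  \<comment> \<open>The domain of \<open>f\<close> is the set of failing \<alpha>, each with the
    number of a neighborhood at which it fails.\<close>
  define f where "f \<alpha> = (if \<exists>k. bad \<alpha> k then Some (SOME k. bad \<alpha> k) else None)" for \<alpha>
  have f: "bad \<alpha> (the (f \<alpha>))" if "\<alpha> \<in> dom f" for \<alpha>
    using that someI_ex[of "bad \<alpha>"] unfolding f_def by (auto split: if_splits)
  have "countable (dom f)"
  proof (rule ccontr)
    assume unc: "uncountable (dom f)"
    let ?p = "(fst p, insert (v, f) (snd p))"
    have "?p \<in> P" by (rule add_promise[OF p v unc])
    then obtain r where r: "r \<in> D" "le r ?p" using D(2) by blast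
    \<comment> \<open>Adding a promise changes no section, so the same sets are kept relative to
      \<open>?p\<close> and to \<open>p\<close>.\<close>
    have sec: "sec ?p = sec p" by (auto simp: cond_section_def)
    have kept: "kept_set \<B> X w h r ?p = kept_set \<B> X w h r p" for w h
      unfolding kept_set_def sec ..
    have "le r p"
    proof (rule leI)
      show "fst p \<subseteq>\<^sub>m fst r" "snd p \<subseteq> snd r" using leD(1,2)[OF r(2)] by auto
      fix w h assume "(w, h) \<in> snd p"
      then have "(w, h) \<in> snd ?p" by simp
      from leD(3,4)[OF r(2) this]
      show "uncountable (kept_set \<B> X w h r p)" "(w, h |` kept_set \<B> X w h r p) \<in> snd r"
        unfolding kept .
    qed
    then obtain i where i: "tr (q i) = tr r" using listed r(1) unfolding G_def by blast
    have "(v, f) \<in> snd ?p" by simp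
    from leD(3)[OF r(2) this] have "uncountable (kept_set \<B> X v f r p)" unfolding kept .
    \<comment> \<open>Discarding the ordinals up to \<open>i\<close> leaves a kept \<alpha> above
      \<open>i\<close>, while \<open>f\<close> was chosen so that no trace listed before \<alpha>
      lies in its neighborhood.\<close>
    moreover have "countable (insert i {..<i})" using countable_lessThan_omega1 by simp
    ultimately have "\<not> kept_set \<B> X v f r p \<subseteq> insert i {..<i}" using countable_subset by blast
    then obtain \<alpha> where \<alpha>: "\<alpha> \<in> kept_set \<B> X v f r p" "i < \<alpha>" by force
    then have "near \<alpha> (the (f \<alpha>)) i" unfolding near_def i unfolding tr_def kept_set_def by blast
    moreover have "\<alpha> \<in> dom f" using \<alpha>(1) unfolding kept_set_def by blast
    ultimately show False using f \<alpha>(2) unfolding bad_def by blast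
  qed
  from omega1_bounded[OF this] obtain b where b: "\<forall>\<alpha>\<in>dom f. \<alpha> < b" ..
  have "\<exists>i<\<alpha>. le (q i) p \<and> (\<forall>\<xi>\<in>v. sec (q i) \<xi> - sec p \<xi> \<subseteq> \<B> (X \<xi>) \<alpha> k)" if "b \<le> \<alpha>" for \<alpha> k
  proof -
    have "\<alpha> \<notin> dom f" using b that by (meson not_le)
    then have "\<not> bad \<alpha> k" unfolding f_def by (auto simp: domIff split: if_splits)
    then obtain i where "i < \<alpha>" "near \<alpha> k i" unfolding bad_def by blast
    moreover have "le (q i) p" using qG[of i] unfolding G_def by blast
    ultimately show ?thesis unfolding near_def tr_def by blast
  qed
  moreover have "\<forall>i. q i \<in> D" using qG unfolding G_def by blast
  ultimately show ?thesis by blast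
qed

text \<open>Safety gives a box of filter members free of banned points. By diagonalization each of
  its finitely many factors contains all but countably many diagonal points, so almost every
  \<alpha> gives a point of the box.\<close>

lemma promise_catches_diagonal:
  assumes v: "finite v" "v \<subseteq> K" and f: "uncountable (dom f)"
  shows "countable {\<alpha>. countable {\<beta> \<in> dom f. \<forall>\<xi>\<in>v. e (X \<xi>) \<alpha> \<in> \<B> (X \<xi>) \<beta> (the (f \<beta>))}}"
proof -
  have "\<not> dangerous \<U> \<B> X v" using safe v unfolding safe_def by blast
  then have "\<not> large (product_filter \<U> X v) (ban \<B> X v f)"
    using f unfolding dangerous_def is_promise_def by blast
  then obtain C where C: "C \<in> product_filter \<U> X v" "ban \<B> X v f \<inter> C = {}"
    unfolding large_def by blast
  then obtain A where A: "\<And>\<xi>. \<xi> \<in> v \<Longrightarrow> A \<xi> \<in> \<U> (X \<xi>)" "Pi\<^sub>E v A \<subseteq> C"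
    using product_filter_box[of v X \<U> C] data(2) v(2) by blast
  let ?S = "\<Union>\<xi>\<in>v. {\<alpha>. e (X \<xi>) \<alpha> \<notin> A \<xi>}"
  have "countable {\<alpha>. e (X \<xi>) \<alpha> \<notin> A \<xi>}" if \<xi>: "\<xi> \<in> v" for \<xi>
  proof -
    have \<xi>K: "\<xi> \<in> K" using \<xi> v(2) by blast
    have inj: "inj (e (X \<xi>))" and ran: "range (e (X \<xi>)) = Y (X \<xi>)"
      using data(5)[OF \<xi>K] unfolding right_separated_by_def bij_betw_def by auto
    have "countable (Y (X \<xi>) - A \<xi>)" using data(4)[OF \<xi>K] A(1)[OF \<xi>] unfolding diagonalizes_def by blast
    moreover have "e (X \<xi>) ` {\<alpha>. e (X \<xi>) \<alpha> \<notin> A \<xi>} \<subseteq> Y (X \<xi>) - A \<xi>" using ran by blast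
    ultimately have "countable (e (X \<xi>) ` {\<alpha>. e (X \<xi>) \<alpha> \<notin> A \<xi>})" using countable_subset by blast
    then show ?thesis by (rule countable_image_inj_on) (use inj in \<open>auto simp: inj_on_def\<close>)
  qed
  then have "countable ?S" using v(1) countable_finite by blast
  moreover have "uncountable {\<beta> \<in> dom f. \<forall>\<xi>\<in>v. e (X \<xi>) \<alpha> \<in> \<B> (X \<xi>) \<beta> (the (f \<beta>))}"
    if \<alpha>: "\<alpha> \<notin> ?S" for \<alpha>
  proof -
    let ?x = "\<lambda>\<xi>\<in>v. e (X \<xi>) \<alpha>"
    have "?x \<in> Pi\<^sub>E v A" using \<alpha> by auto
    then have "?x \<notin> ban \<B> X v f" using A(2) C(2) by blast
    moreover have "?x \<in> topspace (product_topology X v)"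
    proof -
      have "e (X \<xi>) \<alpha> \<in> topspace (X \<xi>)" if "\<xi> \<in> v" for \<xi>
        using diagonal_in that v(2) by blast
      then show ?thesis by simp
    qed
    ultimately have "uncountable {\<beta> \<in> dom f. \<forall>\<xi>\<in>v. ?x \<xi> \<in> \<B> (X \<xi>) \<beta> (the (f \<beta>))}"
      unfolding ban_def by blast
    moreover have "{\<beta> \<in> dom f. \<forall>\<xi>\<in>v. ?x \<xi> \<in> \<B> (X \<xi>) \<beta> (the (f \<beta>))} =
      {\<beta> \<in> dom f. \<forall>\<xi>\<in>v. e (X \<xi>) \<alpha> \<in> \<B> (X \<xi>) \<beta> (the (f \<beta>))}" by auto
    ultimately show ?thesis by simp
  qed
  ultimately show ?thesis
    by (intro countable_subset[of "{\<alpha>. countable {\<beta> \<in> dom f. \<forall>\<xi>\<in>v. e (X \<xi>) \<alpha> \<in> \<B> (X \<xi>) \<beta> (the (f \<beta>))}}" ?S])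
      blast+
qed

text \<open>A condition has countably many promises, each with countably many exceptional \<alpha>,
  and \<open>b\<close> bounds them all.\<close>

lemma condition_catches_diagonal:
  assumes "p \<in> P"
  shows "\<exists>b. \<forall>\<alpha>\<ge>b. \<forall>(v, f)\<in>snd p.
    uncountable {\<beta> \<in> dom f. \<forall>\<xi>\<in>v. e (X \<xi>) \<alpha> \<in> \<B> (X \<xi>) \<beta> (the (f \<beta>))}"
proof -
  let ?S = "\<lambda>(v, f). {\<alpha>. countable {\<beta> \<in> dom f. \<forall>\<xi>\<in>v. e (X \<xi>) \<alpha> \<in> \<B> (X \<xi>) \<beta> (the (f \<beta>))}}"
  have "countable (?S t)" if "t \<in> snd p" for t
    using condD(5)[OF assms] promise_catches_diagonal that by (cases t) auto
  then have "countable (\<Union>t\<in>snd p. ?S t)" using condD(4)[OF assms] by blast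
  from omega1_bounded[OF this] obtain b where b: "\<forall>\<alpha>\<in>(\<Union>t\<in>snd p. ?S t). \<alpha> < b" ..
  have "uncountable {\<beta> \<in> dom f. \<forall>\<xi>\<in>v. e (X \<xi>) \<alpha> \<in> \<B> (X \<xi>) \<beta> (the (f \<beta>))}"
    if "b \<le> \<alpha>" "(v, f) \<in> snd p" for \<alpha> v f
  proof
    assume "countable {\<beta> \<in> dom f. \<forall>\<xi>\<in>v. e (X \<xi>) \<alpha> \<in> \<B> (X \<xi>) \<beta> (the (f \<beta>))}"
    then have "\<alpha> \<in> ?S (v, f)" by simp
    then have "\<alpha> < b" using b that(2) by blast
    then show False using that(1) by simp
  qed
  then show ?thesis by blast
qed

end

section \<open>Generic chains\<close>

text \<open>Requirements need not be downward closed under \<open>ord\<close>, so each of them is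
  scheduled infinitely often and met beyond any given stage.\<close>

lemma rasiowa_sikorski_sequence:
  fixes S :: "'s set" and \<R> :: "'s set set"
  assumes \<R>: "countable \<R>" "\<R> \<noteq> {}" and s0: "s0 \<in> S"
    and step: "\<And>R s. R \<in> \<R> \<Longrightarrow> s \<in> S \<Longrightarrow> \<exists>s'\<in>S. ord s' s \<and> s' \<in> R"
  shows "\<exists>s. s 0 = s0 \<and> (\<forall>n. s n \<in> S \<and> ord (s (Suc n)) (s n)) \<and> (\<forall>R\<in>\<R>. \<forall>n. \<exists>m\<ge>n. s m \<in> R)"
proof -
  \<comment> \<open>The first component of \<open>prod_decode n\<close> names the requirement
    treated at step \<open>n\<close>; the second only makes it recur.\<close>
  define R where "R n = from_nat_into \<R> (fst (prod_decode n))" for n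
  have R: "R n \<in> \<R>" for n unfolding R_def by (rule from_nat_into[OF \<R>(2)])
  have "\<exists>s. \<forall>n. (s n \<in> S \<and> (n = 0 \<longrightarrow> s n = s0)) \<and> ord (s (Suc n)) (s n) \<and> s (Suc n) \<in> R n"
  proof (rule dependent_nat_choice)
    fix s and n :: nat assume "s \<in> S \<and> (n = 0 \<longrightarrow> s = s0)"
    then show "\<exists>s'. (s' \<in> S \<and> (Suc n = 0 \<longrightarrow> s' = s0)) \<and> ord s' s \<and> s' \<in> R n"
      using step[OF R] by auto
  qed (use s0 in blast)
  then obtain s where s: "\<And>n. s n \<in> S" "s 0 = s0" "\<And>n. ord (s (Suc n)) (s n)" "\<And>n. s (Suc n) \<in> R n"
    by blast
  have "\<exists>m\<ge>n. s m \<in> A" if A: "A \<in> \<R>" for A n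
  proof -
    obtain k where k: "from_nat_into \<R> k = A" using from_nat_into_surj[OF \<R>(1) A] by blast
    have "R (prod_encode (k, n)) = A" unfolding R_def using k by simp
    moreover have "n \<le> Suc (prod_encode (k, n))" using le_prod_encode_2[of n k] by simp
    ultimately show ?thesis using s(4) by metis
  qed
  then show ?thesis using s by blast
qed

context safe_collection
begin

text \<open>The bound is the union of the functions, with all promises and their restrictions to
  what is kept up to the limit. The hypotheses say exactly that these restrictions are promises and
  that the limit sections have small closure.\<close>

lemma lower_bound:
  fixes p :: "nat \<Rightarrow> ('k, 'a) cond"
  assumes p: "\<And>n. p n \<in> P" and dec: "\<And>m n. m \<le> n \<Longrightarrow> le (p n) (p m)"
    and kept: "\<And>n v f. (v, f) \<in> snd (p n) \<Longrightarrow>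
      uncountable {\<beta> \<in> dom f. \<forall>\<xi>\<in>v. (\<Union>m. sec (p m) \<xi>) - sec (p n) \<xi> \<subseteq> \<B> (X \<xi>) \<beta> (the (f \<beta>))}"
    and closed: "\<And>\<xi>. \<xi> \<in> K \<Longrightarrow> X \<xi> closure_of (\<Union>m. sec (p m) \<xi>) \<notin> \<U> (X \<xi>)"
  shows "\<exists>q\<in>P. \<forall>n. le q (p n)"
proof -
  \<comment> \<open>The value is read off at the first stage where it is defined; all later stages
    agree.\<close>
  define a where "a x = (if \<exists>n. x \<in> dom (fst (p n)) then fst (p (LEAST n. x \<in> dom (fst (p n)))) x else None)" for x
  have ext: "fst (p n) \<subseteq>\<^sub>m a" for n
    unfolding map_le_def
  proof
    fix x assume n: "x \<in> dom (fst (p n))"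
    let ?l = "LEAST n. x \<in> dom (fst (p n))"
    have l: "x \<in> dom (fst (p ?l))" by (rule LeastI[of "\<lambda>n. x \<in> dom (fst (p n))", OF n])
    have "?l \<le> n" by (rule Least_le[of "\<lambda>n. x \<in> dom (fst (p n))", OF n])
    then have "fst (p ?l) \<subseteq>\<^sub>m fst (p n)" using leD(1) dec by blast
    then have "fst (p ?l) x = fst (p n) x" using l unfolding map_le_def by blast
    moreover have "a x = fst (p ?l) x" using n unfolding a_def by auto
    ultimately show "fst (p n) x = a x" by simp
  qed
  have a_Some: "\<exists>n. fst (p n) x = Some y" if "a x = Some y" for x y
    using that unfolding a_def by (auto split: if_splits)
  have sec_a: "sec (a, \<Phi>) \<xi> = (\<Union>m. sec (p m) \<xi>)" for \<Phi> \<xi>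
  proof
    show "sec (a, \<Phi>) \<xi> \<subseteq> (\<Union>m. sec (p m) \<xi>)"
      using a_Some unfolding cond_section_def by fastforce
    show "(\<Union>m. sec (p m) \<xi>) \<subseteq> sec (a, \<Phi>) \<xi>"
    proof
      fix x assume "x \<in> (\<Union>m. sec (p m) \<xi>)"
      then obtain m where m: "fst (p m) (\<xi>, x) = Some True" unfolding cond_section_def by blast
      then have "a (\<xi>, x) = Some True" using ext[of m] unfolding map_le_def by (metis domI)
      then show "x \<in> sec (a, \<Phi>) \<xi>" unfolding cond_section_def by simp
    qed
  qed
  \<comment> \<open>A kept set depends only on the sections, so the dummy \<open>(a, {})\<close>
    avoids defining the promises of the limit in terms of themselves.\<close>
  define r where "r n t = (fst t, snd t |` kept_set \<B> X (fst t) (snd t) (a, {}) (p n))" for n t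
  define \<Phi> where "\<Phi> = (\<Union>n. snd (p n)) \<union> (\<Union>n. r n ` snd (p n))"
  let ?q = "(a, \<Phi>)"
  have kept_q: "kept_set \<B> X v f ?q (p n) = kept_set \<B> X v f (a, {}) (p n)" for v f n
    unfolding kept_set_def sec_a ..
  have unc: "uncountable (kept_set \<B> X v f ?q (p n))" if "(v, f) \<in> snd (p n)" for v f n
    using kept[OF that] unfolding kept_set_def sec_a .
  have "?q \<in> P"
  proof (rule condI)
    have dom_a: "dom (fst ?q) \<subseteq> (\<Union>n. dom (fst (p n)))" using a_Some by (fastforce simp: dom_def)
    show "countable (dom (fst ?q))"
      by (rule countable_subset[OF dom_a]) (use condD(1)[OF p] in blast)
    show "dom (fst ?q) \<subseteq> Sigma K (\<lambda>\<xi>. topspace (X \<xi>))"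
      using dom_a condD(2)[OF p] by blast
    show "\<And>\<xi>. \<xi> \<in> K \<Longrightarrow> X \<xi> closure_of sec ?q \<xi> \<notin> \<U> (X \<xi>)" unfolding sec_a by (rule closed)
    show "countable (snd ?q)" unfolding \<Phi>_def using condD(4)[OF p] by simp
    fix v f assume "(v, f) \<in> snd ?q"
    then consider n where "(v, f) \<in> snd (p n)" | n where "(v, f) \<in> r n ` snd (p n)"
      unfolding \<Phi>_def by auto
    then show "finite v \<and> v \<subseteq> K \<and> uncountable (dom f)"
    proof cases
      case 1
      then show ?thesis by (rule condD(5)[OF p])
    next
      case (2 n)
      then obtain w g where wg: "(w, g) \<in> snd (p n)" "(v, f) = r n (w, g)" by force
      have "kept_set \<B> X w g (a, {}) (p n) \<subseteq> dom g" unfolding kept_set_def by blast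
      then have "dom f = kept_set \<B> X w g (a, {}) (p n)" using wg(2) unfolding r_def by auto
      then show ?thesis
        using unc[OF wg(1)] condD(5)[OF p wg(1)] wg(2) unfolding kept_q r_def by simp
    qed
  qed
  moreover have "le ?q (p n)" for n
  proof (rule leI)
    show "fst (p n) \<subseteq>\<^sub>m fst ?q" using ext by simp
    show "snd (p n) \<subseteq> snd ?q" unfolding \<Phi>_def by auto
    fix v f assume vf: "(v, f) \<in> snd (p n)"
    show "uncountable (kept_set \<B> X v f ?q (p n))" by (rule unc[OF vf])
    have "(v, f |` kept_set \<B> X v f ?q (p n)) = r n (v, f)" unfolding kept_q r_def by simp
    moreover have "r n (v, f) \<in> snd ?q" using vf unfolding \<Phi>_def by auto
    ultimately show "(v, f |` kept_set \<B> X v f ?q (p n)) \<in> snd ?q" by (simp only:)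
  qed
  ultimately show ?thesis by blast
qed

text \<open>The extensions made after a stage \<open>(p, v, k)\<close> may only add points of the \<open>k\<close>-th neighborhood
  of \<open>\<delta>\<close> in the coordinates from \<open>v\<close>. A promise \<open>(w, f)\<close> of \<open>p\<close> is kept forever once \<open>w \<subseteq> v\<close> and \<open>k\<close>
  is so large that this neighborhood of \<open>\<delta>\<close> lies in those prescribed for uncountably many \<open>\<beta>\<close>.\<close>

lemma generic_chain:
  assumes Q: "countable Q" "Q \<subseteq> P" and \<D>: "countable \<D>" "\<D> \<noteq> {}"
    and V: "\<And>v. v \<in> V \<Longrightarrow> finite v \<and> v \<subseteq> K" "{} \<in> V" "\<And>v w. v \<in> V \<Longrightarrow> w \<in> V \<Longrightarrow> v \<union> w \<in> V"
      "\<And>p v f. p \<in> Q \<Longrightarrow> (v, f) \<in> snd p \<Longrightarrow> v \<in> V"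
      "\<And>p \<xi> x. p \<in> Q \<Longrightarrow> (\<xi>, x) \<in> dom (fst p) \<Longrightarrow> {\<xi>} \<in> V"
    and ext: "\<And>p D v k. p \<in> Q \<Longrightarrow> D \<in> \<D> \<Longrightarrow> v \<in> V \<Longrightarrow>
      \<exists>q\<in>Q \<inter> D. le q p \<and> (\<forall>\<xi>\<in>v. sec q \<xi> - sec p \<xi> \<subseteq> \<B> (X \<xi>) \<delta> k)"
    and catch: "\<And>p v f. p \<in> Q \<Longrightarrow> (v, f) \<in> snd p \<Longrightarrow>
      uncountable {\<beta> \<in> dom f. \<forall>\<xi>\<in>v. e (X \<xi>) \<delta> \<in> \<B> (X \<xi>) \<beta> (the (f \<beta>))}"
    and p0: "p0 \<in> Q"
  shows "\<exists>Z\<subseteq>Q. p0 \<in> Z \<and> (\<forall>x\<in>Z. \<forall>y\<in>Z. le x y \<or> le y x) \<and> (\<forall>D\<in>\<D>. D \<inter> Z \<noteq> {}) \<and>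
    (\<exists>q\<in>P. \<forall>x\<in>Z. le q x)"
proof -
  define S :: "(('k, 'a) cond \<times> 'k set \<times> nat) set" where "S = Q \<times> V \<times> UNIV"
  define ord where "ord = (\<lambda>(q, w, l :: nat) (p, v, k :: nat). le q p \<and> v \<subseteq> w \<and> k \<le> l \<and>
    (\<forall>\<xi>\<in>v. sec q \<xi> - sec p \<xi> \<subseteq> \<B> (X \<xi>) \<delta> k))"
  \<comment> \<open>The \<beta> for which \<open>f\<close> has been kept from \<open>r\<close> to
    \<open>p\<close> and will remain kept as long as new points stay in the k-th neighborhood of
    \<delta>.\<close>
  define T where "T p k r w f = {\<beta> \<in> dom f. \<forall>\<xi>\<in>w. sec p \<xi> - sec r \<xi> \<subseteq> \<B> (X \<xi>) \<beta> (the (f \<beta>)) \<and>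
      \<B> (X \<xi>) \<delta> k \<subseteq> \<B> (X \<xi>) \<beta> (the (f \<beta>))}" for p k and r :: "('k, 'a) cond" and w :: "'k set" and f :: promise
  \<comment> \<open>Three kinds of requirements: \<open>RD\<close> meets a dense set,
    \<open>RP\<close> secures a promise of \<open>r\<close> at stages below \<open>r\<close>, and
    \<open>RC\<close> secures small closure in one coordinate.\<close>
  define RD where "RD D = D \<times> (UNIV :: ('k set \<times> nat) set)" for D :: "('k, 'a) cond set"
  define RP where "RP = (\<lambda>(r, w, f). {(p, v, k). le p r \<longrightarrow> w \<subseteq> v \<and> uncountable (T p k r w f)})"
  define RC where "RC \<xi> = (UNIV :: ('k, 'a) cond set) \<times>
    {(v, k). \<xi> \<in> v \<and> X \<xi> closure_of \<B> (X \<xi>) \<delta> k \<notin> \<U> (X \<xi>)}" for \<xi>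
  define promises where "promises = (SIGMA r:Q. snd r)"
  define L where "L = (\<Union>p\<in>Q. fst ` dom (fst p))"
  define \<R> where "\<R> = RD ` \<D> \<union> RP ` promises \<union> RC ` L"
  have QP: "p \<in> P" if "p \<in> Q" for p using that Q(2) by blast
  have VK: "\<xi> \<in> K" if "v \<in> V" "\<xi> \<in> v" for v \<xi> using V(1) that by blast
  have ord_stay: "ord (p, w, l) (p, v, k)" if "p \<in> Q" "v \<subseteq> w" "k \<le> l" for p v w k l
    using that le_refl[OF QP] unfolding ord_def by auto
  have "countable promises"
    unfolding promises_def using Q(1) condD(4)[OF QP] by (intro countable_SIGMA) auto
  moreover have "countable L"
    unfolding L_def using Q(1) condD(1)[OF QP] by (intro countable_UN countable_image) auto
  ultimately have "countable \<R>" using \<D>(1) unfolding \<R>_def by simp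
  moreover have "\<R> \<noteq> {}" using \<D>(2) unfolding \<R>_def by blast
  moreover have "(p0, {}, 0) \<in> S" using p0 V(2) unfolding S_def by simp
  moreover have "\<exists>s'\<in>S. ord s' s \<and> s' \<in> R" if R: "R \<in> \<R>" and s: "s \<in> S" for R s
  proof -
    obtain p v k where s_eq: "s = (p, v, k)" and p: "p \<in> Q" and v: "v \<in> V" using s unfolding S_def by blast
    consider D where "D \<in> \<D>" "R = RD D" | r w f where "r \<in> Q" "(w, f) \<in> snd r" "R = RP (r, w, f)"
      | \<xi> where "\<xi> \<in> L" "R = RC \<xi>"
      using R unfolding \<R>_def promises_def by auto
    then show ?thesis
    proof cases
      case (1 D)
      obtain q where q: "q \<in> Q" "q \<in> D" "le q p" "\<forall>\<xi>\<in>v. sec q \<xi> - sec p \<xi> \<subseteq> \<B> (X \<xi>) \<delta> k"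
        using ext[OF p 1(1) v] by blast
      have "(q, v, k) \<in> S" "ord (q, v, k) s" "(q, v, k) \<in> R"
        using q v unfolding S_def ord_def s_eq 1(2) RD_def by auto
      then show ?thesis by blast
    next
      case (2 r w f)
      show ?thesis
      proof (cases "le p r")
        case False
        then have "s \<in> R" unfolding 2(3) RP_def s_eq by simp
        moreover have "ord s s" using ord_stay[OF p] unfolding s_eq by simp
        ultimately show ?thesis using s by blast
      next
        case True
        have w: "w \<in> V" by (rule V(4)[OF 2(1,2)])
        \<comment> \<open>As \<open>p\<close> is below \<open>r\<close>, this restriction is a
          promise of \<open>p\<close> itself, so \<open>catch\<close> applies to it.\<close>
        let ?f = "f |` kept_set \<B> X w f p r"
        let ?C = "{\<beta> \<in> dom ?f. \<forall>\<xi>\<in>w. e (X \<xi>) \<delta> \<in> \<B> (X \<xi>) \<beta> (the (?f \<beta>))}"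
        have "uncountable ?C" by (rule catch[OF p leD(4)[OF True 2(2)]])
        \<comment> \<open>Finiteness of \<open>w\<close> gives one number \<open>l\<close> for all
          coordinates. There are only countably many \<open>l\<close>, so one of them serves
          uncountably many \<beta>.\<close>
        moreover have "?C \<subseteq> (\<Union>l. T p l r w f)"
        proof
          fix \<beta> assume "\<beta> \<in> ?C"
          then have \<beta>: "\<beta> \<in> kept_set \<B> X w f p r" "\<beta> \<in> dom f"
            "\<forall>\<xi>\<in>w. e (X \<xi>) \<delta> \<in> \<B> (X \<xi>) \<beta> (the (f \<beta>))" by auto
          have "\<exists>l. \<B> (X \<xi>) \<delta> l \<subseteq> \<B> (X \<xi>) \<beta> (the (f \<beta>))" if \<xi>: "\<xi> \<in> w" for \<xi>
            using nbhd(3)[OF VK[OF w \<xi>] nbhd(1)[OF VK[OF w \<xi>]]] \<beta>(3) \<xi> by blast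
          then obtain l where l: "\<And>\<xi>. \<xi> \<in> w \<Longrightarrow> \<B> (X \<xi>) \<delta> (l \<xi>) \<subseteq> \<B> (X \<xi>) \<beta> (the (f \<beta>))" by metis
          have fin: "finite (l ` w)" using V(1)[OF w] by simp
          have "\<B> (X \<xi>) \<delta> (Max (l ` w)) \<subseteq> \<B> (X \<xi>) \<beta> (the (f \<beta>))" if \<xi>: "\<xi> \<in> w" for \<xi>
          proof -
            have "l \<xi> \<le> Max (l ` w)" using fin \<xi> by simp
            from nbhd_antimono[OF VK[OF w \<xi>] this] show ?thesis using l[OF \<xi>] by blast
          qed
          then have "\<beta> \<in> T p (Max (l ` w)) r w f"
            using \<beta>(1) unfolding T_def kept_set_def by blast
          then show "\<beta> \<in> (\<Union>l. T p l r w f)" by blast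
        qed
        ultimately have "uncountable (\<Union>l. T p l r w f)" using countable_subset by blast
        then have "\<not> (\<forall>l. countable (T p l r w f))"
          using countable_UN[of UNIV "\<lambda>l. T p l r w f"] by auto
        then obtain l where l: "uncountable (T p l r w f)" by blast
        have "T p l r w f \<subseteq> T p (max k l) r w f"
        proof
          fix \<beta> assume \<beta>: "\<beta> \<in> T p l r w f"
          have "\<B> (X \<xi>) \<delta> (max k l) \<subseteq> \<B> (X \<xi>) \<delta> l" if "\<xi> \<in> w" for \<xi>
            by (rule nbhd_antimono[OF VK[OF w that]]) simp
          then show "\<beta> \<in> T p (max k l) r w f" using \<beta> unfolding T_def by blast
        qed
        then have "uncountable (T p (max k l) r w f)" using l countable_subset by blast
        then have "(p, v \<union> w, max k l) \<in> R" unfolding 2(3) RP_def by simp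
        moreover have "(p, v \<union> w, max k l) \<in> S" using p V(3)[OF v w] unfolding S_def by simp
        moreover have "ord (p, v \<union> w, max k l) s" unfolding s_eq by (rule ord_stay[OF p]) auto
        ultimately show ?thesis by blast
      qed
    next
      case (3 \<xi>)
      then have \<xi>: "{\<xi>} \<in> V" using V(5) unfolding L_def by force
      have \<xi>K: "\<xi> \<in> K" by (rule VK[OF \<xi>]) simp
      obtain l where l: "X \<xi> closure_of \<B> (X \<xi>) \<delta> l \<notin> \<U> (X \<xi>)" using small_nbhd[OF \<xi>K] by blast
      have "X \<xi> closure_of \<B> (X \<xi>) \<delta> (max k l) \<subseteq> X \<xi> closure_of \<B> (X \<xi>) \<delta> l"
        by (intro closure_of_mono nbhd_antimono[OF \<xi>K]) simp
      then have "X \<xi> closure_of \<B> (X \<xi>) \<delta> (max k l) \<notin> \<U> (X \<xi>)"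
        using l closed_filter_up[OF \<xi>K _ closedin_closure_of] by blast
      then have "(p, v \<union> {\<xi>}, max k l) \<in> R" unfolding 3(2) RC_def by simp
      moreover have "(p, v \<union> {\<xi>}, max k l) \<in> S" using p V(3)[OF v \<xi>] unfolding S_def by simp
      moreover have "ord (p, v \<union> {\<xi>}, max k l) s" unfolding s_eq by (rule ord_stay[OF p]) auto
      ultimately show ?thesis by blast
    qed
  qed
  ultimately obtain s where s: "s 0 = (p0, {}, 0)" "\<And>n. s n \<in> S" "\<And>n. ord (s (Suc n)) (s n)"
    "\<And>R n. R \<in> \<R> \<Longrightarrow> \<exists>m\<ge>n. s m \<in> R"
    using rasiowa_sikorski_sequence[of \<R> "(p0, {}, 0)" S ord] by metis
  define p where "p n = fst (s n)" for n
  define v where "v n = fst (snd (s n))" for n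
  define k where "k n = snd (snd (s n))" for n
  have s_eq: "s n = (p n, v n, k n)" for n unfolding p_def v_def k_def by simp
  have pQ: "p n \<in> Q" and vV: "v n \<in> V" for n using s(2)[of n] unfolding s_eq S_def by auto
  have later: "le (p n) (p m) \<and> v m \<subseteq> v n \<and> k m \<le> k n \<and>
    (\<forall>\<xi>\<in>v m. sec (p n) \<xi> - sec (p m) \<xi> \<subseteq> \<B> (X \<xi>) \<delta> (k m))" if "m \<le> n" for m n
    using that
  proof (induction n rule: dec_induct)
    case base
    then show ?case using le_refl[OF QP[OF pQ]] by simp
  next
    case (step n)
    have n: "le (p (Suc n)) (p n)" "v n \<subseteq> v (Suc n)" "k n \<le> k (Suc n)"
      "\<And>\<xi>. \<xi> \<in> v n \<Longrightarrow> sec (p (Suc n)) \<xi> - sec (p n) \<xi> \<subseteq> \<B> (X \<xi>) \<delta> (k n)"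
      using s(3)[of n] unfolding s_eq ord_def by auto
    have "sec (p (Suc n)) \<xi> - sec (p m) \<xi> \<subseteq> \<B> (X \<xi>) \<delta> (k m)" if \<xi>: "\<xi> \<in> v m" for \<xi>
    proof -
      have "sec (p (Suc n)) \<xi> - sec (p n) \<xi> \<subseteq> \<B> (X \<xi>) \<delta> (k n)" using n(4) step.IH \<xi> by blast
      moreover have "\<B> (X \<xi>) \<delta> (k n) \<subseteq> \<B> (X \<xi>) \<delta> (k m)"
        using nbhd_antimono[OF VK[OF vV \<xi>]] step.IH by blast
      moreover have "sec (p n) \<xi> - sec (p m) \<xi> \<subseteq> \<B> (X \<xi>) \<delta> (k m)" using step.IH \<xi> by blast
      ultimately show ?thesis by blast
    qed
    moreover have "le (p (Suc n)) (p m)" using le_trans[OF n(1)] step.IH by blast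
    ultimately show ?case using n(2,3) step.IH by auto
  qed
  have tail: "(\<Union>n. sec (p n) \<xi>) - sec (p m) \<xi> \<subseteq> \<B> (X \<xi>) \<delta> (k m)" if \<xi>: "\<xi> \<in> v m" for m \<xi>
  proof
    fix x assume "x \<in> (\<Union>n. sec (p n) \<xi>) - sec (p m) \<xi>"
    then obtain n where n: "x \<in> sec (p n) \<xi>" "x \<notin> sec (p m) \<xi>" by blast
    show "x \<in> \<B> (X \<xi>) \<delta> (k m)"
    proof (cases "m \<le> n")
      case True
      then show ?thesis using later[OF True] n \<xi> by blast
    next
      case False
      then have "le (p m) (p n)" using later[of n m] by simp
      from sec_mono[OF this] show ?thesis using n by blast
    qed
  qed
  have "\<exists>q\<in>P. \<forall>n. le q (p n)"
  proof (rule lower_bound)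
    show "p n \<in> P" for n by (rule QP[OF pQ])
    show "le (p n) (p m)" if "m \<le> n" for m n using later[OF that] by blast
  next
    fix n w f assume wf: "(w, f) \<in> snd (p n)"
    then have "RP (p n, w, f) \<in> \<R>" using pQ[of n] unfolding \<R>_def promises_def by blast
    \<comment> \<open>The stage is taken at or after \<open>n\<close>, so that the premise of
      \<open>RP\<close> holds there.\<close>
    then obtain m where m: "n \<le> m" "s m \<in> RP (p n, w, f)" using s(4) by blast
    have "le (p m) (p n)" using later[OF m(1)] by blast
    then have wv: "w \<subseteq> v m" and unc: "uncountable (T (p m) (k m) (p n) w f)"
      using m(2) unfolding s_eq RP_def by simp_all
    have "T (p m) (k m) (p n) w f \<subseteq>
      {\<beta> \<in> dom f. \<forall>\<xi>\<in>w. (\<Union>m. sec (p m) \<xi>) - sec (p n) \<xi> \<subseteq> \<B> (X \<xi>) \<beta> (the (f \<beta>))}"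
    proof
      fix \<beta> assume \<beta>: "\<beta> \<in> T (p m) (k m) (p n) w f"
      have "(\<Union>m. sec (p m) \<xi>) - sec (p n) \<xi> \<subseteq> \<B> (X \<xi>) \<beta> (the (f \<beta>))" if \<xi>: "\<xi> \<in> w" for \<xi>
      proof -
        have "\<xi> \<in> v m" using wv \<xi> by blast
        from tail[OF this] show ?thesis using \<beta> \<xi> unfolding T_def by blast
      qed
      then show "\<beta> \<in> {\<beta> \<in> dom f. \<forall>\<xi>\<in>w. (\<Union>m. sec (p m) \<xi>) - sec (p n) \<xi> \<subseteq> \<B> (X \<xi>) \<beta> (the (f \<beta>))}"
        using \<beta> unfolding T_def by blast
    qed
    from countable_subset[OF this] unc
    show "uncountable {\<beta> \<in> dom f. \<forall>\<xi>\<in>w. (\<Union>m. sec (p m) \<xi>) - sec (p n) \<xi> \<subseteq> \<B> (X \<xi>) \<beta> (the (f \<beta>))}"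
      by (rule contrapos_nn[rotated])
  next
    fix \<xi> assume \<xi>K: "\<xi> \<in> K"
    show "X \<xi> closure_of (\<Union>m. sec (p m) \<xi>) \<notin> \<U> (X \<xi>)"
    proof (cases "\<xi> \<in> L")
      case False
      have "sec (p m) \<xi> = {}" for m
      proof (rule ccontr)
        assume "sec (p m) \<xi> \<noteq> {}"
        then obtain x where "(\<xi>, x) \<in> dom (fst (p m))" unfolding cond_section_def by blast
        then show False using False pQ[of m] unfolding L_def by force
      qed
      then show ?thesis using closure_of_empty_notin[OF \<xi>K] by simp
    next
      case True
      then have "RC \<xi> \<in> \<R>" unfolding \<R>_def by blast
      then obtain m where "s m \<in> RC \<xi>" using s(4) by blast
      then have m: "\<xi> \<in> v m" "X \<xi> closure_of \<B> (X \<xi>) \<delta> (k m) \<notin> \<U> (X \<xi>)"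
        unfolding s_eq RC_def by simp_all
      \<comment> \<open>The closure of the limit section is covered by two closed sets outside the
        filter, hence by a closed set outside it.\<close>
      have "(\<Union>m. sec (p m) \<xi>) \<subseteq> sec (p m) \<xi> \<union> \<B> (X \<xi>) \<delta> (k m)" using tail[OF m(1)] by blast
      from closure_of_mono[OF this, of "X \<xi>"]
      have sub: "X \<xi> closure_of (\<Union>m. sec (p m) \<xi>) \<subseteq>
        X \<xi> closure_of sec (p m) \<xi> \<union> X \<xi> closure_of \<B> (X \<xi>) \<delta> (k m)" by simp
      show ?thesis
      proof
        assume "X \<xi> closure_of (\<Union>m. sec (p m) \<xi>) \<in> \<U> (X \<xi>)"
        from closed_filter_up[OF \<xi>K this closedin_Un[OF closedin_closure_of closedin_closure_of] sub]
        show False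
          using maximal_closed_filter_Un[OF data(1)[OF \<xi>K] closedin_closure_of closedin_closure_of]
            m(2) condD(3)[OF QP[OF pQ] \<xi>K] by blast
      qed
    qed
  qed
  then obtain q where q: "q \<in> P" "\<And>n. le q (p n)" by blast
  have "range p \<subseteq> Q" using pQ by blast
  moreover have "p0 \<in> range p" using s(1) s_eq[of 0] by (metis Pair_inject rangeI)
  moreover have "le x y \<or> le y x" if xy: "x \<in> range p" "y \<in> range p" for x y
  proof -
    obtain m n where "x = p m" "y = p n" using xy by blast
    then show ?thesis using later[of m n] later[of n m] by (cases "m \<le> n") auto
  qed
  moreover have "D \<inter> range p \<noteq> {}" if D: "D \<in> \<D>" for D
  proof -
    have "RD D \<in> \<R>" using D unfolding \<R>_def by blast
    then obtain m where "s m \<in> RD D" using s(4) by blast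
    then have "p m \<in> D" unfolding s_eq RD_def by simp
    then show ?thesis by blast
  qed
  ultimately show ?thesis using q by (intro exI[of _ "range p"]) blast
qed

text \<open>A condition that codes the finite set \<open>v\<close> and the countable ordinal \<open>i\<close>, so that a closed set
  of conditions determines which \<open>v\<close> and \<open>i\<close> belong to it.\<close>

definition marker :: "'k set \<Rightarrow> omega1 \<Rightarrow> ('k, 'a) cond" where
  "marker v i = (Map.empty, {(v, \<lambda>\<beta>. Some (if \<beta> = i then 1 else 0))})"

lemma marker_inject: "marker v i = marker w j \<longleftrightarrow> v = w \<and> i = j"
proof
  assume "marker v i = marker w j"
  then have v: "v = w" and "(\<lambda>\<beta>. Some (if \<beta> = i then 1 else 0 :: nat)) = (\<lambda>\<beta>. Some (if \<beta> = j then 1 else 0))"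
    unfolding marker_def by simp_all
  from fun_cong[OF this(2), of i] show "v = w \<and> i = j" using v by (auto split: if_splits)
qed simp

lemma marker_in: "marker v i \<in> P \<longleftrightarrow> finite v \<and> v \<subseteq> K"
proof
  have "(v, \<lambda>\<beta>. Some (if \<beta> = i then 1 else 0)) \<in> snd (marker v i)" unfolding marker_def by simp
  then show "marker v i \<in> P \<Longrightarrow> finite v \<and> v \<subseteq> K" using condD(5) by blast
next
  assume v: "finite v \<and> v \<subseteq> K"
  have "dom (\<lambda>\<beta>. Some (if \<beta> = i then 1 else 0 :: nat)) = UNIV" by auto
  then have unc: "uncountable (dom (\<lambda>\<beta>. Some (if \<beta> = i then 1 else 0 :: nat)))"
    using uncountable_omega1 by simp
  show "marker v i \<in> P"
  proof (rule condI)
    have "sec (marker v i) \<xi> = {}" for \<xi> unfolding marker_def cond_section_def by simp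
    then show "\<And>\<xi>. \<xi> \<in> K \<Longrightarrow> X \<xi> closure_of sec (marker v i) \<xi> \<notin> \<U> (X \<xi>)"
      using closure_of_empty_notin by simp
  next
    fix w f assume "(w, f) \<in> snd (marker v i)"
    then have "w = v" "f = (\<lambda>\<beta>. Some (if \<beta> = i then 1 else 0))" unfolding marker_def by simp_all
    then show "finite w \<and> w \<subseteq> K \<and> uncountable (dom f)" using v unc by simp
  qed (simp_all add: marker_def)
qed

section \<open>The closure operation on conditions\<close>

text \<open>The sets of coordinates that \<open>generic_chain\<close> requires in \<open>V\<close>
  on account of \<open>p\<close>; the empty set is always among them.\<close>

definition supports :: "('k, 'a) cond \<Rightarrow> 'k set set" where
  "supports p = insert {} (fst ` snd p \<union> (\<lambda>x. {fst x}) ` dom (fst p))"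

lemma supports:
  assumes "p \<in> P"
  shows "countable (supports p)" "v \<in> supports p \<Longrightarrow> finite v \<and> v \<subseteq> K"
proof -
  show "countable (supports p)" unfolding supports_def using condD(1,4)[OF assms] by simp
  assume "v \<in> supports p"
  then consider "v = {}" | f where "(v, f) \<in> snd p" | \<xi> x where "v = {\<xi>}" "(\<xi>, x) \<in> dom (fst p)"
    unfolding supports_def by force
  then show "finite v \<and> v \<subseteq> K"
    by cases (use condD(2,5)[OF assms] in auto)
qed

text \<open>The operation \<open>A\<close> makes the markers in a closed set \<open>Q\<close> record
  its finite sets and its ordinals. The supremum \<delta> of these ordinals plays the role of
  \<open>N \<inter> omega1\<close>, and \<open>generic_chain\<close> is applied at \<delta>.\<close>

lemma totally_proper_conds: "totally_proper TYPE('m) P le"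
proof -
  define near where "near p D v = (\<lambda>(q :: omega1 \<Rightarrow> ('k, 'a) cond, b). (\<forall>i. q i \<in> D) \<and>
    (\<forall>\<alpha>\<ge>b. \<forall>k. \<exists>i<\<alpha>. le (q i) p \<and> (\<forall>\<xi>\<in>v. sec (q i) \<xi> - sec p \<xi> \<subseteq> \<B> (X \<xi>) \<alpha> k)))"
    for p :: "('k, 'a) cond" and D v
  define q where "q p D v = fst (SOME t. near p D v t)" for p D v
  define b where "b p D v = snd (SOME t. near p D v t)" for p D v
  have near: "near p D v (q p D v, b p D v)"
    if "p \<in> P" "D \<subseteq> P" "\<forall>x\<in>P. \<exists>y\<in>D. le y x" "finite v" "v \<subseteq> K" for p D v
  proof -
    have "\<exists>q b. near p D v (q, b)"
      unfolding near_def prod.case by (rule dense_extensions_near_diagonal) (use that in blast)+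
    then have "\<exists>t. near p D v t" by blast
    from someI_ex[OF this] show ?thesis unfolding q_def b_def by simp
  qed
  have q: "q p D v i \<in> D"
    if "p \<in> P" "D \<subseteq> P" "\<forall>x\<in>P. \<exists>y\<in>D. le y x" "finite v" "v \<subseteq> K" for p D v i
    using near[OF that] unfolding near_def by blast
  have b: "\<exists>i<\<alpha>. le (q p D v i) p \<and> (\<forall>\<xi>\<in>v. sec (q p D v i) \<xi> - sec p \<xi> \<subseteq> \<B> (X \<xi>) \<alpha> k)"
    if "p \<in> P" "D \<subseteq> P" "\<forall>x\<in>P. \<exists>y\<in>D. le y x" "finite v" "v \<subseteq> K" "b p D v \<le> \<alpha>" for p D v \<alpha> k
    using near[OF that(1-5)] that(6) unfolding near_def by blast
  define catches where "catches p b \<longleftrightarrow> (\<forall>\<alpha>\<ge>b. \<forall>(v, f)\<in>snd p.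
    uncountable {\<beta> \<in> dom f. \<forall>\<xi>\<in>v. e (X \<xi>) \<alpha> \<in> \<B> (X \<xi>) \<beta> (the (f \<beta>))})"
    for p :: "('k, 'a) cond" and b
  define b' where "b' p = (SOME b. catches p b)" for p
  have b': "uncountable {\<beta> \<in> dom f. \<forall>\<xi>\<in>v. e (X \<xi>) \<alpha> \<in> \<B> (X \<xi>) \<beta> (the (f \<beta>))}"
    if "p \<in> P" "b' p \<le> \<alpha>" "(v, f) \<in> snd p" for p \<alpha> v f
  proof -
    have "\<exists>b. catches p b" unfolding catches_def by (rule condition_catches_diagonal[OF that(1)])
    from someI_ex[OF this] show ?thesis
      using that(2,3) unfolding b'_def catches_def by blast
  qed
  \<comment> \<open>\<open>A1\<close> adds the bound \<open>b p D v\<close> and the listed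
    extensions with index up to \<beta>, \<open>A2\<close> the supports and the bound
    \<open>b' p\<close>, and \<open>A3\<close> unions and maxima. Markers are injective, so the
    unions in \<open>A1\<close> and \<open>A3\<close> have at most one index.\<close>
  define A1 where "A1 p r D = (\<Union>(v, \<beta>)\<in>{(v, \<beta>). r = marker v \<beta>}. insert (marker v (b p D v)) (q p D v ` insert \<beta> {..<\<beta>}))" for p r D
  define A2 where "A2 p = (\<lambda>v. marker v (b' p)) ` supports p" for p
  define A3 where "A3 p r = (\<Union>(v, w, \<beta>, \<gamma>)\<in>{(v, w, \<beta>, \<gamma>). p = marker v \<beta> \<and> r = marker w \<gamma>}.
    {marker (v \<union> w) (max \<beta> \<gamma>), marker v (max \<beta> \<gamma>)})" for p r
  \<comment> \<open>The intersection discards the arbitrary values that \<open>q\<close> may take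
    when \<open>D\<close> is not dense.\<close>
  define A where "A p r D = (A1 p r D \<union> A2 p \<union> A3 p r) \<inter> P" for p r D
  have A1: "countable (A1 p r D)" for p r D
  proof -
    have "\<exists>!t. t \<in> {(v, \<beta>). r = marker v \<beta>}" if "{(v, \<beta>). r = marker v \<beta>} \<noteq> {}"
      using that by (auto simp: marker_inject)
    then have "countable {(v, \<beta>). r = marker v \<beta>}"
      by (metis countable_empty countable_finite finite.simps is_singletonI' is_singleton_the_elem)
    then show ?thesis unfolding A1_def using countable_lessThan_omega1 by auto
  qed
  have A3: "countable (A3 p r)" for p r
  proof -
    let ?I = "{(v, w, \<beta>, \<gamma>). p = marker v \<beta> \<and> r = marker w \<gamma>}"
    have "\<And>s t. s \<in> ?I \<Longrightarrow> t \<in> ?I \<Longrightarrow> s = t" by (auto simp: marker_inject)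
    then have "countable ?I"
      by (metis countable_empty countable_finite finite.simps is_singletonI' is_singleton_the_elem)
    then show ?thesis unfolding A3_def by auto
  qed
  show ?thesis
  proof (rule totally_properI[of P le A])
    fix p assume "p \<in> P"
    then show "le p p" by (rule le_refl)
  next
    fix p r D assume "p \<in> P"
    then show "countable (A p r D) \<and> A p r D \<subseteq> P"
      unfolding A_def A2_def using A1 A3 supports(1) by auto
  next
    fix Q \<D> p0
    assume Q: "countable Q" "countable \<D>" "Q \<subseteq> P" "P \<in> \<D>" and D: "\<And>D. D \<in> \<D> \<Longrightarrow> D \<subseteq> P \<and> (\<forall>x\<in>P. \<exists>y\<in>D. le y x)"
      and closed: "\<And>p r D. p \<in> Q \<Longrightarrow> r \<in> Q \<Longrightarrow> D \<in> \<D> \<Longrightarrow> A p r D \<subseteq> Q" and p0: "p0 \<in> Q"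
    define V where "V = {v. \<exists>i. marker v i \<in> Q}"
    define I where "I = {i. \<exists>v. marker v i \<in> Q}"
    have QP: "p \<in> P" if "p \<in> Q" for p using that Q(3) by blast
    have V_fin: "finite v \<and> v \<subseteq> K" if "v \<in> V" for v
      using that Q(3) marker_in unfolding V_def by blast
    have supp: "marker v (b' p) \<in> Q" if "p \<in> Q" "v \<in> supports p" for p v
    proof -
      have "marker v (b' p) \<in> P" using supports(2)[OF QP[OF that(1)] that(2)] marker_in by blast
      then have "marker v (b' p) \<in> A p p P" using that(2) unfolding A_def A2_def by blast
      then show ?thesis using closed that(1) Q(4) by blast
    qed
    have join: "marker (v \<union> w) (max \<beta> \<gamma>) \<in> Q" "marker v (max \<beta> \<gamma>) \<in> Q"
      if vw: "marker v \<beta> \<in> Q" "marker w \<gamma> \<in> Q" for v w \<beta> \<gamma>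
    proof -
      have "finite v \<and> v \<subseteq> K" "finite w \<and> w \<subseteq> K" using vw V_fin unfolding V_def by blast+
      then have "marker (v \<union> w) (max \<beta> \<gamma>) \<in> P" "marker v (max \<beta> \<gamma>) \<in> P" unfolding marker_in by auto
      then have "marker (v \<union> w) (max \<beta> \<gamma>) \<in> A (marker v \<beta>) (marker w \<gamma>) P"
        "marker v (max \<beta> \<gamma>) \<in> A (marker v \<beta>) (marker w \<gamma>) P"
        unfolding A_def A3_def by blast+
      then show "marker (v \<union> w) (max \<beta> \<gamma>) \<in> Q" "marker v (max \<beta> \<gamma>) \<in> Q"
        using closed[OF vw Q(4)] by blast+
    qed
    have listed: "marker v (b p D v) \<in> Q" "i \<le> \<beta> \<Longrightarrow> q p D v i \<in> Q"
      if p: "p \<in> Q" and DD: "D \<in> \<D>" and v: "marker v \<beta> \<in> Q" for p D v \<beta> i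
    proof -
      have vK: "finite v" "v \<subseteq> K" using v V_fin unfolding V_def by blast+
      have "marker v (b p D v) \<in> A p (marker v \<beta>) D"
        unfolding A_def A1_def using vK marker_in by blast
      then show "marker v (b p D v) \<in> Q" using closed[OF p v DD] by blast
      assume "i \<le> \<beta>"
      then have "i \<in> insert \<beta> {..<\<beta>}" by auto
      moreover have "q p D v i \<in> P" using q[OF QP[OF p] _ _ vK] D[OF DD] by blast
      ultimately have "q p D v i \<in> A p (marker v \<beta>) D" unfolding A_def A1_def by blast
      then show "q p D v i \<in> Q" using closed[OF p v DD] by blast
    qed
    have "countable I"
    proof -
      have "I \<subseteq> (\<lambda>p. THE i. \<exists>v. p = marker v i) ` Q"
      proof
        fix i assume "i \<in> I"
        then obtain v where v: "marker v i \<in> Q" unfolding I_def by blast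
        have "i = (THE j. \<exists>w. marker v i = marker w j)" by (auto simp: marker_inject)
        then show "i \<in> (\<lambda>p. THE i. \<exists>v. p = marker v i) ` Q" using v by (rule image_eqI)
      qed
      then show ?thesis using Q(1) countable_subset by blast
    qed
    from omega1_bounded[OF this] have ex: "\<exists>d. \<forall>i\<in>I. i < d" .
    \<comment> \<open>The least strict upper bound: bounds recorded in \<open>Q\<close> lie below
      \<delta>, and each ordinal below \<delta> is at most one recorded in \<open>Q\<close>.\<close>
    define \<delta> where "\<delta> = (LEAST d. \<forall>i\<in>I. i < d)"
    have \<delta>: "i < \<delta>" if "i \<in> I" for i using LeastI_ex[OF ex] that unfolding \<delta>_def by blast
    have below: "\<exists>i\<in>I. \<alpha> \<le> i" if "\<alpha> < \<delta>" for \<alpha>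
      using not_less_Least[of \<alpha> "\<lambda>d. \<forall>i\<in>I. i < d"] that unfolding \<delta>_def by (meson not_le)
    show "\<exists>Z\<subseteq>Q. p0 \<in> Z \<and> (\<forall>x\<in>Z. \<forall>y\<in>Z. le x y \<or> le y x) \<and> (\<forall>D\<in>\<D>. D \<inter> Z \<noteq> {}) \<and> (\<exists>q\<in>P. \<forall>x\<in>Z. le q x)"
    proof (rule generic_chain[OF Q(1,3,2), of V \<delta>])
      show "\<D> \<noteq> {}" using Q(4) by blast
      show "p0 \<in> Q" by (rule p0)
      show "\<And>v. v \<in> V \<Longrightarrow> finite v \<and> v \<subseteq> K" by (rule V_fin)
      show "{} \<in> V" using supp[OF p0, of "{}"] unfolding V_def supports_def by blast
      show "\<And>v w. v \<in> V \<Longrightarrow> w \<in> V \<Longrightarrow> v \<union> w \<in> V" using join(1) unfolding V_def by blast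
    next
      fix p v f assume "p \<in> Q" "(v, f) \<in> snd p"
      moreover from this have "v \<in> supports p" unfolding supports_def by force
      ultimately show "v \<in> V" using supp unfolding V_def by blast
    next
      fix p \<xi> x assume "p \<in> Q" "(\<xi>, x) \<in> dom (fst p)"
      moreover from this have "{\<xi>} \<in> supports p" unfolding supports_def by force
      ultimately show "{\<xi>} \<in> V" using supp unfolding V_def by blast
    next
      fix p D v k assume p: "p \<in> Q" and DD: "D \<in> \<D>" and v: "v \<in> V"
      obtain \<beta> where \<beta>: "marker v \<beta> \<in> Q" using v unfolding V_def by blast
      \<comment> \<open>Since the bound is below \<delta>, a suitable extension has an index
        \<open>i\<close> below \<delta>. Raising the ordinal of the marker of \<open>v\<close> to at
        least \<open>i\<close> puts this extension into \<open>Q\<close>.\<close>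
      have "b p D v \<le> \<delta>" by (rule less_imp_le, rule \<delta>) (use listed(1)[OF p DD \<beta>] in \<open>unfold I_def, blast\<close>)
      then obtain i where i: "i < \<delta>" "le (q p D v i) p"
        "\<forall>\<xi>\<in>v. sec (q p D v i) \<xi> - sec p \<xi> \<subseteq> \<B> (X \<xi>) \<delta> k"
        using b[OF QP[OF p], of D v \<delta> k] D[OF DD] V_fin[OF v] by auto
      obtain j w where j: "i \<le> j" "marker w j \<in> Q" using below[OF i(1)] unfolding I_def by blast
      have "i \<le> max \<beta> j" using j(1) by (simp add: max.coboundedI2)
      from listed(2)[OF p DD join(2)[OF \<beta> j(2)] this] have "q p D v i \<in> Q" .
      moreover have "q p D v i \<in> D" using q[OF QP[OF p], of D v i] D[OF DD] V_fin[OF v] by blast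
      ultimately show "\<exists>q\<in>Q \<inter> D. le q p \<and> (\<forall>\<xi>\<in>v. sec q \<xi> - sec p \<xi> \<subseteq> \<B> (X \<xi>) \<delta> k)"
        using i(2,3) by blast
    next
      fix p v f assume p: "p \<in> Q" and vf: "(v, f) \<in> snd p"
      \<comment> \<open>The empty support records \<open>b' p\<close> even when \<open>p\<close> has
        no promises and an empty function.\<close>
      have "marker {} (b' p) \<in> Q" by (rule supp[OF p]) (simp add: supports_def)
      then have "b' p < \<delta>" by (intro \<delta>) (unfold I_def, blast)
      then show "uncountable {\<beta> \<in> dom f. \<forall>\<xi>\<in>v. e (X \<xi>) \<delta> \<in> \<B> (X \<xi>) \<beta> (the (f \<beta>))}"
        by (intro b'[OF QP[OF p] _ vf]) simp
    qed
  qed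
qed

end

theorem theorem3:
  fixes \<U> :: "'a topology \<Rightarrow> 'a set set"
    and Y :: "'a topology \<Rightarrow> 'a set"
    and e :: "'a topology \<Rightarrow> omega1 \<Rightarrow> 'a"
    and \<B> :: "'a topology \<Rightarrow> omega1 \<Rightarrow> nat \<Rightarrow> 'a set"
    and K :: "'k set"
    and X :: "'k \<Rightarrow> 'a topology"
  assumes CH
    and "fixed_data \<U> Y e \<B>"
    and "\<forall>\<xi>\<in>K. relevant (X \<xi>)"
    and "safe \<U> \<B> K X"
  shows "totally_proper TYPE('m) (conds \<U> K X) (cond_le \<B> X)"
proof -
  interpret safe_collection \<U> Y e \<B> K X
    by unfold_locales (use assms in blast)+
  show ?thesis by (rule totally_proper_conds)
qed

end
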